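(* Under a graph isomorphism $C_4\times C_4\xrightarrow{\sim}Q_4$, the $384$ most-perfect $4\times4$ magic squares form the single orbit of the Khajuraho Magic Square under the faithful action of the group $\mathrm{Aut}_{\mathrm{graph}}(C_4\times C_4)=\mathrm{Aut}(Q_4)\cong W(B_4)=C_2^4\rtimes S_4$, of order $16\times24=384$.
   Context: A most-perfect $4\times4$ magic square is an arrangement of the numbers $1,\ldots,16$ in a $4\times4$ square such that every row, column, $2\times2$ subsquare (including those that wrap around, i.e. positions $\{i,i+1\}\times\{j,j+1\}$ modulo $4$), and every diagonal and pandiagonal (wrap-around, or broken, diagonal) sums to the same magic constant ($34$). The Khajuraho Magic Square is the $4\times 4$ square with rows, from top to bottom, $$(7,12,1,14),\quad(2,13,8,11),\quad(16,3,10,5),\quad(9,6,15,4).$$ $C_4\times C_4$ is the Cartesian product of two $4$-cycles, i.e. the toroidal $4\times4$ grid graph, whose vertices are the positions of the square; $Q_4$ is the hypercube graph on $\{0,1\}^4$. Graph automorphisms of $C_4\times C_4$ act on arrangements of $1,\ldots,16$ by permuting positions. $W(B_4)$ is the hyperoctahedral group of order $384$. *)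

theory Defs
  imports "HOL-Algebra.Algebra" "HOL-Library.Numeral_Type"
begin

text \<open>
  A graph is given by its adjacency relation on a vertex type.  The numeral type \<open>4\<close> is the
  ring of integers modulo 4, so index arithmetic on it wraps around.
\<close>

definition graph_isos :: "('a \<Rightarrow> 'a \<Rightarrow> bool) \<Rightarrow> ('b \<Rightarrow> 'b \<Rightarrow> bool) \<Rightarrow> ('a \<Rightarrow> 'b) set"
  where "graph_isos E F = {f. bij f \<and> (\<forall>x y. F (f x) (f y) \<longleftrightarrow> E x y)}"

definition graph_aut :: "('a \<Rightarrow> 'a \<Rightarrow> bool) \<Rightarrow> ('a \<Rightarrow> 'a) monoid"
  where "graph_aut E = \<lparr>carrier = graph_isos E E, monoid.mult = (\<circ>), one = id\<rparr>"

definition cartesian_graph_product ::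
    "('a \<Rightarrow> 'a \<Rightarrow> bool) \<Rightarrow> ('b \<Rightarrow> 'b \<Rightarrow> bool) \<Rightarrow> 'a \<times> 'b \<Rightarrow> 'a \<times> 'b \<Rightarrow> bool"
  where "cartesian_graph_product E F = (\<lambda>(a, b) (c, d). (E a c \<and> b = d) \<or> (a = c \<and> F b d))"

definition C4 :: "4 \<Rightarrow> 4 \<Rightarrow> bool"
  where "C4 i j \<longleftrightarrow> j = i + 1 \<or> i = j + 1"

definition C4xC4 :: "4 \<times> 4 \<Rightarrow> 4 \<times> 4 \<Rightarrow> bool"
  where "C4xC4 = cartesian_graph_product C4 C4"

text \<open>Here the type \<open>4\<close> only serves as a set of four coordinates.\<close>

definition Q4 :: "(4 \<Rightarrow> bool) \<Rightarrow> (4 \<Rightarrow> bool) \<Rightarrow> bool"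
  where "Q4 x y \<longleftrightarrow> (\<exists>!i. x i \<noteq> y i)"


text \<open>A square \<open>M\<close> has entry \<open>M (i, j)\<close> in row \<open>i\<close> and column \<open>j\<close>, both counted from 0.\<close>

type_synonym square = "4 \<times> 4 \<Rightarrow> nat"

definition arrangements :: "square set"
  where "arrangements = {M. bij_betw M UNIV {1..16}}"

definition most_perfect_squares :: "square set"
  where "most_perfect_squares = {M \<in> arrangements.
    (\<forall>i. (\<Sum>j\<in>UNIV. M (i, j)) = 34) \<and>
    (\<forall>j. (\<Sum>i\<in>UNIV. M (i, j)) = 34) \<and>
    (\<forall>i j. M (i, j) + M (i, j + 1) + M (i + 1, j) + M (i + 1, j + 1) = 34) \<and>
    (\<forall>d. (\<Sum>i\<in>UNIV. M (i, d + i)) = 34) \<and>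
    (\<forall>d. (\<Sum>i\<in>UNIV. M (i, d - i)) = 34)}"

definition quad :: "'a \<Rightarrow> 'a \<Rightarrow> 'a \<Rightarrow> 'a \<Rightarrow> 4 \<Rightarrow> 'a"
  where "quad a b c d i = (if i = 0 then a else if i = 1 then b else if i = 2 then c else d)"

definition khajuraho :: square
  where "khajuraho = (\<lambda>(i, j).
    quad (quad  7 12  1 14)
         (quad  2 13  8 11)
         (quad 16  3 10  5)
         (quad  9  6 15  4) i j)"

text \<open>
  The entry at position \<open>x\<close> is moved to position \<open>g x\<close>.  The restriction to the set \<open>S\<close> of squares
  acted on makes this an element of \<^term>\<open>BijGroup S\<close>.
\<close>

definition position_action :: "square set \<Rightarrow> (4 \<times> 4 \<Rightarrow> 4 \<times> 4) \<Rightarrow> square \<Rightarrow> square"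
  where "position_action S g = (\<lambda>M\<in>S. M \<circ> inv_into UNIV g)"


definition semidirect_product ::
    "('a, 'm) monoid_scheme \<Rightarrow> ('b, 'n) monoid_scheme \<Rightarrow> ('b \<Rightarrow> 'a \<Rightarrow> 'a) \<Rightarrow> ('a \<times> 'b) monoid"
  where "semidirect_product N H \<theta> =
    \<lparr>carrier = carrier N \<times> carrier H,
     monoid.mult = (\<lambda>(n, h) (n', h'). (n \<otimes>\<^bsub>N\<^esub> \<theta> h n', h \<otimes>\<^bsub>H\<^esub> h')),
     one = (\<one>\<^bsub>N\<^esub>, \<one>\<^bsub>H\<^esub>)\<rparr>"

definition C2_power :: "nat \<Rightarrow> (nat \<Rightarrow> int) monoid"
  where "C2_power n = product_group {1..n} (\<lambda>_. integer_mod_group 2)"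

definition permute_coords :: "nat \<Rightarrow> (nat \<Rightarrow> nat) \<Rightarrow> (nat \<Rightarrow> 'a) \<Rightarrow> nat \<Rightarrow> 'a"
  where "permute_coords n \<sigma> v = (\<lambda>i\<in>{1..n}. v (inv_into UNIV \<sigma> i))"

text \<open>
  The hyperoctahedral group \<open>W(B\<^sub>n)\<close>, realised as the signed permutations, i.e. the permutations
  \<open>p\<close> of \<open>{-n, \<dots>, -1, 1, \<dots>, n}\<close> with \<open>p (-k) = - p k\<close>.
\<close>

definition W_B :: "nat \<Rightarrow> (int \<Rightarrow> int) monoid"
  where "W_B n = \<lparr>carrier = {p. p permutes ({- int n..int n} - {0}) \<and> (\<forall>k. p (- k) = - p k)},
                  monoid.mult = (\<circ>), one = id\<rparr>"


lemma group_graph_aut: "group (graph_aut E)"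
proof (rule groupI)
  fix f assume "f \<in> carrier (graph_aut E)"
  then have f: "bij f" "\<And>x y. E (f x) (f y) \<longleftrightarrow> E x y"
    by (auto simp: graph_aut_def graph_isos_def)
  have "inv_into UNIV f \<in> carrier (graph_aut E)"
    using f bij_imp_bij_inv[OF f(1)]
    by (simp add: graph_aut_def graph_isos_def) (metis f bij_inv_eq_iff)
  moreover have "inv_into UNIV f \<circ> f = id"
    using f(1) by (simp add: bij_is_inj)
  ultimately show "\<exists>g \<in> carrier (graph_aut E). g \<otimes>\<^bsub>graph_aut E\<^esub> f = \<one>\<^bsub>graph_aut E\<^esub>"
    by (auto simp: graph_aut_def)
qed (auto simp: graph_aut_def graph_isos_def bij_comp)

lemma group_semidirect_product:
  assumes N: "group N" and H: "group H" and \<theta>: "\<And>h. h \<in> carrier H \<Longrightarrow> \<theta> h \<in> hom N N"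
    and one: "\<And>x. x \<in> carrier N \<Longrightarrow> \<theta> \<one>\<^bsub>H\<^esub> x = x"
    and mult: "\<And>g h x. g \<in> carrier H \<Longrightarrow> h \<in> carrier H \<Longrightarrow> x \<in> carrier N \<Longrightarrow>
                 \<theta> (g \<otimes>\<^bsub>H\<^esub> h) x = \<theta> g (\<theta> h x)"
  shows "group (semidirect_product N H \<theta>)"
proof -
  interpret N: group N by (rule N)
  interpret H: group H by (rule H)
  have cl: "\<theta> h x \<in> carrier N" if "h \<in> carrier H" "x \<in> carrier N" for h x
    using \<theta>[OF that(1)] that(2) by (auto simp: hom_def)
  have hm: "\<theta> h (x \<otimes>\<^bsub>N\<^esub> y) = \<theta> h x \<otimes>\<^bsub>N\<^esub> \<theta> h y"
    if "h \<in> carrier H" "x \<in> carrier N" "y \<in> carrier N" for h x y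
    using \<theta>[OF that(1)] that(2,3) by (auto simp: hom_def)
  have h1: "\<theta> h \<one>\<^bsub>N\<^esub> = \<one>\<^bsub>N\<^esub>" if "h \<in> carrier H" for h
    using \<theta>[OF that] hom_one[OF _ N N] by blast
  show ?thesis
  proof (rule groupI)
    fix x assume "x \<in> carrier (semidirect_product N H \<theta>)"
    then obtain n h where x: "x = (n, h)" and n: "n \<in> carrier N" and h: "h \<in> carrier H"
      by (auto simp: semidirect_product_def)
    let ?k = "inv\<^bsub>H\<^esub> h"
    let ?y = "(\<theta> ?k (inv\<^bsub>N\<^esub> n), ?k)"
    have "\<theta> ?k (inv\<^bsub>N\<^esub> n) \<otimes>\<^bsub>N\<^esub> \<theta> ?k n = \<one>\<^bsub>N\<^esub>"
      using n h hm[of ?k "inv\<^bsub>N\<^esub> n" n] h1[of ?k] by simp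
    then show "\<exists>y\<in>carrier (semidirect_product N H \<theta>).
        y \<otimes>\<^bsub>semidirect_product N H \<theta>\<^esub> x = \<one>\<^bsub>semidirect_product N H \<theta>\<^esub>"
      using n h cl by (intro bexI[of _ ?y]) (auto simp: x semidirect_product_def)
  qed (auto simp: semidirect_product_def cl hm mult one N.m_assoc H.m_assoc)
qed

end

theory Submission
  imports Defs
begin

text \<open>
  An automorphism of \<open>Q\<^sub>4\<close> is a coordinate permutation followed by a translation, because the
  direction of the image of an edge is constant along 4-cycles.  A Gray code identifies \<open>C\<^sub>4 \<times> C\<^sub>4\<close>
  with \<open>Q\<^sub>4\<close>; rows, columns and \<open>2 \<times> 2\<close> subsquares become the 24 two-dimensional faces of the cube,
  and the diagonal conditions become the condition that antipodal entries sum to 17.  Hence most-perfect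
  squares are the bijections satisfying a condition that is visibly invariant under \<open>Aut(Q\<^sub>4)\<close>.
  Such a function is determined by its values at a vertex and its four neighbours.  Around the
  vertex with entry 1 the neighbours have entries \<open>16 - p\<^sub>i\<close>, and since all of \<open>1, \<dots>, 16\<close> occur
  exactly once, the subset sums of the \<open>p\<^sub>i\<close> are \<open>0, \<dots>, 15\<close>; so \<open>{p\<^sub>i} = {1, 2, 4, 8}\<close>, and any two
  most-perfect squares differ by an automorphism, which is unique because the entries are distinct.
\<close>

section \<open>Automorphisms of the hypercube\<close>

text \<open>Sums of two representatives among 0 to 3 reach at most 6, so these rules return such
  sums, and negatives, to a representative.\<close>

lemma numeral_4 [simp]: "(4::4) = 0" "(5::4) = 1" "(6::4) = 2"
  "(- 1::4) = 3" "(- 2::4) = 2" "(- 3::4) = 1"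
  by (simp_all add: eq_neg_iff_add_eq_0 neg_eq_iff_add_eq_0)

lemma distinct_4 [simp]: "(0::4) \<noteq> 1" "(0::4) \<noteq> 2" "(0::4) \<noteq> 3" "(1::4) \<noteq> 2" "(1::4) \<noteq> 3" "(2::4) \<noteq> 3"
  "(1::4) \<noteq> 0" "(2::4) \<noteq> 0" "(3::4) \<noteq> 0" "(2::4) \<noteq> 1" "(3::4) \<noteq> 1" "(3::4) \<noteq> 2"
  by simp_all

lemma UNIV_4: "(UNIV :: 4 set) = {0, 1, 2, 3}"
proof -
  have "x \<in> {0, 1, 2, 3}" for x :: 4
  proof (cases x)
    case (of_int z)
    then have "z = 0 \<or> z = 1 \<or> z = 2 \<or> z = 3" by auto
    then show ?thesis using of_int by auto
  qed
  then show ?thesis by blast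
qed

lemma cases_4:
  fixes i :: 4
  obtains "i = 0" | "i = 1" | "i = 2" | "i = 3"
  using UNIV_4 by auto

lemma all_4: "(\<forall>i::4. P i) \<longleftrightarrow> P 0 \<and> P 1 \<and> P 2 \<and> P 3"
  using UNIV_4 by (metis UNIV_I insertE singletonD)

lemma ex_4: "(\<exists>i::4. P i) \<longleftrightarrow> P 0 \<or> P 1 \<or> P 2 \<or> P 3"
  using all_4[of "\<lambda>i. \<not> P i"] by blast

lemma sum_4:
  fixes f :: "4 \<Rightarrow> 'a::comm_monoid_add"
  shows "(\<Sum>i\<in>UNIV. f i) = f 0 + f 1 + f 2 + f 3"
  unfolding UNIV_4 by (simp add: add.assoc)

section \<open>Edges of the cube as coordinate flips\<close>

definition flip :: "'i \<Rightarrow> ('i \<Rightarrow> bool) \<Rightarrow> 'i \<Rightarrow> bool"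
  where "flip i x = x(i := \<not> x i)"

text \<open>On booleans \<open>\<noteq>\<close> is addition modulo 2, so identities between flips
  and translations become propositional.\<close>

lemma flip_apply: "flip i x j = (x j \<noteq> (i = j))"
  by (auto simp: flip_def)

lemma flip_eq_iff [simp]: "flip i x = flip j x \<longleftrightarrow> i = j"
  by (auto simp: fun_eq_iff flip_apply)

lemma flip_flip [simp]: "flip i (flip i x) = x"
  by (auto simp: fun_eq_iff flip_apply)

lemma flip_commute: "flip i (flip j x) = flip j (flip i x)"
  by (auto simp: fun_eq_iff flip_apply)

lemma Q4_iff_flip: "Q4 x y \<longleftrightarrow> (\<exists>i. y = flip i x)"
  unfolding Q4_def Ex1_def fun_eq_iff flip_apply by metis

lemma Q4_flip [simp]: "Q4 x (flip i x)"
  by (auto simp: Q4_iff_flip)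

text \<open>Connectedness of the cube: the coordinates equal to \<open>True\<close> are switched on
  one at a time, starting from the origin.\<close>

lemma vertex_induct [case_names base flip]:
  fixes x :: "'i::finite \<Rightarrow> bool"
  assumes "P (\<lambda>i. False)" and "\<And>x i. P x \<Longrightarrow> P (flip i x)"
  shows "P x"
proof -
  have "P (\<lambda>i. i \<in> A)" if "finite A" for A :: "'i set"
    using that
  proof induction
    case (insert a A)
    have "flip a (\<lambda>i. i \<in> A) = (\<lambda>i. i \<in> insert a A)"
      using insert.hyps by (auto simp: fun_eq_iff flip_apply)
    then show ?case using assms(2)[OF insert.IH, of a] by simp
  qed (use assms in simp)
  from this[of "{i. x i}"] show ?thesis by simp
qed

lemma graph_isosD:
  assumes "f \<in> graph_isos E F"
  shows "bij f" "F (f x) (f y) \<longleftrightarrow> E x y"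
  using assms by (auto simp: graph_isos_def)

lemma graph_isos_inv:
  assumes "f \<in> graph_isos E F"
  shows "inv' f \<in> graph_isos F E"
proof -
  note f = graph_isosD[OF assms]
  have "E (inv' f x) (inv' f y) \<longleftrightarrow> F x y" for x y
    using f(2)[of "inv' f x" "inv' f y"] f(1) by (simp add: bij_is_surj surj_f_inv_f)
  then show ?thesis using f(1) by (simp add: graph_isos_def bij_imp_bij_inv)
qed

lemma graph_isos_comp:
  assumes "f \<in> graph_isos E F" "g \<in> graph_isos F H"
  shows "g \<circ> f \<in> graph_isos E H"
  using assms by (auto simp: graph_isos_def intro: bij_comp)

text \<open>An automorphism maps each 4-cycle \<open>x\<close>, \<open>x + e\<^sub>i\<close>, \<open>x + e\<^sub>i + e\<^sub>j\<close>, \<open>x + e\<^sub>j\<close> to a 4-cycle, so the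
  direction in which the edge \<open>x\<close>, \<open>x + e\<^sub>i\<close> is mapped does not depend on \<open>x\<close>.\<close>

lemma aut_Q4_cases:
  assumes "g \<in> graph_isos Q4 Q4"
  obtains \<pi> a where "bij \<pi>" "\<And>x i. g x (\<pi> i) = (x i \<noteq> a i)"
proof -
  note g = graph_isosD[OF assms]
  have inj: "g x = g y \<longleftrightarrow> x = y" for x y using g(1) by (auto dest: bij_is_inj injD)
  have "\<forall>x i. \<exists>k. g (flip i x) = flip k (g x)"
    using g(2) Q4_iff_flip Q4_flip by metis
  then obtain k where k: "\<And>x i. g (flip i x) = flip (k x i) (g x)" by metis
  have k_inj: "k x i = k x j \<longleftrightarrow> i = j" for x i j
    using k[of i x] k[of j x] inj by (metis flip_eq_iff)
  have k_flip: "k (flip j x) i = k x i" for i j x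
  proof (cases "i = j")
    case True
    have "flip (k (flip i x) i) (flip (k x i) (g x)) = g x"
      using k[of i "flip i x"] k[of i x] by simp
    then show ?thesis using True flip_flip flip_eq_iff by metis
  next
    case False
    \<comment> \<open>The two routes around the 4-cycle flip the same coordinates. The first flips
      two distinct ones by injectivity of \<open>g\<close>, so the two pairs agree;
      \<open>k x i\<close> differs from \<open>k x j\<close>, hence equals
      \<open>k (flip j x) i\<close>.\<close>
    have "flip (k (flip j x) i) (flip (k x j) (g x)) = flip (k (flip i x) j) (flip (k x i) (g x))"
      using k[of i "flip j x"] k[of j x] k[of j "flip i x"] k[of i x] by (metis flip_commute)
    then have "flip (k (flip j x) i) (flip (k x j) (g x)) l = flip (k (flip i x) j) (flip (k x i) (g x)) l" for l
      by (rule arg_cong)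
    then have "(k (flip j x) i = l) = (k x j = l) \<longleftrightarrow> (k (flip i x) j = l) = (k x i = l)" for l
      unfolding flip_apply by (cases "g x l") (simp_all, blast+)
    moreover have "k (flip j x) i \<noteq> k x j"
      using k[of i "flip j x"] k[of j x] inj[of "flip i (flip j x)" x] False
      by (metis flip_eq_iff flip_flip)
    ultimately show ?thesis using k_inj[of x i j] False by metis
  qed
  define \<pi> where "\<pi> = k (\<lambda>i. False)"
  have k_eq: "k x i = \<pi> i" for x i
    by (induction x rule: vertex_induct) (simp_all add: \<pi>_def k_flip)
  have inj_\<pi>: "inj \<pi>" using k_inj by (auto simp: inj_def \<pi>_def)
  then have "bij \<pi>" by (simp add: bij_def finite_UNIV_inj_surj)
  have \<pi>_eq: "\<pi> i = \<pi> j \<longleftrightarrow> i = j" for i j by (simp add: k_inj \<pi>_def)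
  \<comment> \<open>The translation part is the image of the origin, pulled back along
    \<open>\<pi>\<close> so that it is indexed by source coordinates.\<close>
  have "g x (\<pi> i) = (x i \<noteq> g (\<lambda>i. False) (\<pi> i))" for x i
  proof (induction x rule: vertex_induct)
    case (flip x j)
    then show ?case unfolding k k_eq flip_apply[of "\<pi> j"] flip_apply[of j x i] \<pi>_eq by blast
  qed simp
  then show ?thesis by (rule that[OF \<open>bij \<pi>\<close>])
qed

lemma surj_eqI:
  assumes "surj \<pi>" "\<And>i. x (\<pi> i) = y (\<pi> i)"
  shows "x = y"
proof
  fix j
  obtain i where "j = \<pi> i" using assms(1) by (rule surjE)
  then show "x j = y j" using assms(2) by simp
qed

text \<open>The translation \<open>a\<close> cancels in differences, so only \<open>\<pi>\<close>
  acts on edge directions.\<close>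

lemma flip_equivariant:
  assumes "bij \<pi>" "\<And>x i. g x (\<pi> i) = (x i \<noteq> a i)"
  shows "g (flip i x) = flip (\<pi> i) (g x)"
proof (rule surj_eqI[OF bij_is_surj[OF assms(1)]])
  fix j
  have "\<pi> i = \<pi> j \<longleftrightarrow> i = j" using assms(1) by (auto dest: bij_is_inj injD)
  then show "g (flip i x) (\<pi> j) = flip (\<pi> i) (g x) (\<pi> j)"
    unfolding flip_apply assms(2) by blast
qed

text \<open>Converse of \<open>aut_Q4_cases\<close>. Preimages are explicit because adding
  \<open>a\<close> twice is the identity, and \<open>flip_equivariant\<close> matches the edges at
  \<open>x\<close> with those at \<open>g x\<close>.\<close>

lemma aut_Q4I:
  fixes \<pi> :: "4 \<Rightarrow> 4"
  assumes "bij \<pi>" "\<And>x i. g x (\<pi> i) = (x i \<noteq> a i)"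
  shows "g \<in> graph_isos Q4 Q4"
proof -
  note surj = bij_is_surj[OF assms(1)]
  have "inj g"
  proof (intro injI ext)
    fix x y i assume "g x = g y"
    then have "g x (\<pi> i) = g y (\<pi> i)" by simp
    then show "x i = y i" unfolding assms(2) by blast
  qed
  moreover have "g (\<lambda>i. y (\<pi> i) \<noteq> a i) = y" for y
    by (rule surj_eqI[OF surj]) (unfold assms(2), blast)
  then have "surj g" by (rule surjI[where f = "\<lambda>y i. y (\<pi> i) \<noteq> a i"])
  moreover have "Q4 (g x) (g y) \<longleftrightarrow> Q4 x y" for x y
  proof -
    have "Q4 (g x) (g y) \<longleftrightarrow> (\<exists>j. g y = flip j (g x))" by (rule Q4_iff_flip)
    also have "\<dots> \<longleftrightarrow> (\<exists>i. g y = flip (\<pi> i) (g x))" using surj by (metis surjD)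
    also have "\<dots> \<longleftrightarrow> (\<exists>i. g y = g (flip i x))"
      using flip_equivariant[of \<pi> g a, OF assms] by simp
    also have "\<dots> \<longleftrightarrow> Q4 x y" using \<open>inj g\<close> by (simp add: inj_eq Q4_iff_flip)
    finally show ?thesis .
  qed
  ultimately show ?thesis by (simp add: graph_isos_def bij_def)
qed

section \<open>Balanced labellings of the hypercube\<close>

definition balanced :: "((4 \<Rightarrow> bool) \<Rightarrow> nat) \<Rightarrow> bool"
  where "balanced f \<longleftrightarrow>
    (\<forall>x i j. i \<noteq> j \<longrightarrow> f x + f (flip i x) + f (flip j x) + f (flip i (flip j x)) = 34) \<and>
    (\<forall>x. f x + f (\<lambda>i. \<not> x i) = 17)"

text \<open>An automorphism takes a face in directions \<open>i\<close>, \<open>j\<close> to one in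
  directions \<open>\<pi> i\<close>, \<open>\<pi> j\<close>, and complementing commutes with
  permuting and translating coordinates.\<close>

lemma balanced_aut:
  assumes "balanced f" "g \<in> graph_isos Q4 Q4"
  shows "balanced (f \<circ> g)"
proof -
  obtain \<pi> a where \<pi>: "bij \<pi>" and g: "\<And>x i. g x (\<pi> i) = (x i \<noteq> a i)"
    by (rule aut_Q4_cases[OF assms(2)]) (rule that)
  have "\<pi> i = \<pi> j \<longleftrightarrow> i = j" for i j using \<pi> by (auto dest: bij_is_inj injD)
  moreover have "g (flip i x) = flip (\<pi> i) (g x)" for i x
    using \<pi> g by (rule flip_equivariant)
  moreover have "g (\<lambda>i. \<not> x i) = (\<lambda>i. \<not> g x i)" for x
    by (rule surj_eqI[OF bij_is_surj[OF \<pi>]]) (unfold g, blast)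
  ultimately show ?thesis
    using assms(1) by (simp add: balanced_def)
qed

lemma balanced_faceD:
  assumes "balanced f" "i \<noteq> j"
  shows "f x + f (flip i x) + f (flip j x) + f (flip i (flip j x)) = 34"
  using assms unfolding balanced_def by blast

lemma balanced_antipodeD:
  assumes "balanced f"
  shows "f x + f (\<lambda>i. \<not> x i) = 17"
  using assms unfolding balanced_def by blast

text \<open>Three values on a face fix the fourth. The neighbours of \<open>flip i x\<close> are
  \<open>x\<close> and fourth corners of faces at \<open>x\<close>, so the induction carries the
  values at all neighbours along.\<close>

lemma balanced_eqI:
  assumes "balanced f" "balanced f'"
    and "f (\<lambda>i. False) = f' (\<lambda>i. False)"
    and "\<And>i. f (flip i (\<lambda>i. False)) = f' (flip i (\<lambda>i. False))"
  shows "f = f'"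
proof
  fix x
  have "f x = f' x \<and> (\<forall>i. f (flip i x) = f' (flip i x))"
  proof (induction x rule: vertex_induct)
    case base
    show ?case using assms(3,4) by simp
  next
    case (flip x i)
    have "f (flip j (flip i x)) = f' (flip j (flip i x))" for j
    proof (cases "j = i")
      case True
      then show ?thesis using flip by simp
    next
      case False
      then show ?thesis
        using flip balanced_faceD[OF assms(1) False, of x] balanced_faceD[OF assms(2) False, of x]
        by simp
    qed
    then show ?case using flip by simp
  qed
  then show "f x = f' x" ..
qed

text \<open>\<open>S\<close> stands for the set of weights \<open>p i\<close> of a labelling, and
  \<open>15 - v \<in> S\<close> says that \<open>v\<close> is the sum of the other three weights.
  Size bounds exclude that alternative, and then 1, 2, 4 are forced in turn and 8 by the
  total.\<close>

lemma distinct_subset_sums: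
  fixes S :: "nat set"
  assumes "card S = 4" "\<Sum>S = 15" "0 \<notin> S"
    and no_sum: "\<And>x y. x \<in> S \<Longrightarrow> y \<in> S \<Longrightarrow> x \<noteq> y \<Longrightarrow> x + y \<notin> S"
    and attained: "\<And>v. v \<in> {1, 2, 4} \<Longrightarrow>
      v \<in> S \<or> 15 - v \<in> S \<or> (\<exists>x\<in>S. \<exists>y\<in>S. x \<noteq> y \<and> x + y = v)"
  shows "S = {1, 2, 4, 8}"
proof -
  have fin: "finite S" using assms(1) by (simp add: card_ge_0_finite)
  \<comment> \<open>The remaining two weights are distinct and positive, so they add up to at least
    3.\<close>
  have le_12: "x + y \<le> 12" if xy: "x \<in> S" "y \<in> S" "x \<noteq> y" for x y
  proof -
    have "card (S - {x, y}) = 2" using fin xy assms(1) by (simp add: card_Diff_subset)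
    then obtain a b where ab: "S - {x, y} = {a, b}" "a \<noteq> b" by (auto simp: card_2_iff)
    have "S = {x, y, a, b}" using ab xy by blast
    moreover have "a \<notin> {x, y}" "b \<notin> {x, y}" using ab by blast+
    ultimately have "x + y + a + b = 15" "a > 0" "b > 0"
      using assms(2,3) xy ab(2) by auto
    then show ?thesis using ab(2) by linarith
  qed
  have le_11: "x \<le> 11" if xS: "x \<in> S" for x
  proof -
    have "S \<noteq> {x}" using assms(1) by auto
    then obtain y where "y \<in> S" "y \<noteq> x" using xS by blast
    moreover from this have "y > 0" using assms(3) by (metis gr0I)
    ultimately show ?thesis using le_12[OF xS, of y] by linarith
  qed
  have pos: "x > 0" if "x \<in> S" for x using that assms(3) by (metis gr0I)
  have 1: "1 \<in> S"
  proof (rule ccontr)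
    assume "1 \<notin> S"
    moreover have "14 \<notin> S" using le_11[of 14] by auto
    moreover have "1 \<in> S \<or> 14 \<in> S \<or> (\<exists>x\<in>S. \<exists>y\<in>S. x \<noteq> y \<and> x + y = 1)"
      using attained[of 1] by simp
    ultimately obtain x y where "x \<in> S" "y \<in> S" "x + y = 1" by blast
    then show False using pos[of x] pos[of y] by linarith
  qed
  have 2: "2 \<in> S"
  proof (rule ccontr)
    assume "2 \<notin> S"
    moreover have "13 \<notin> S" using le_11[of 13] by auto
    moreover have "2 \<in> S \<or> 13 \<in> S \<or> (\<exists>x\<in>S. \<exists>y\<in>S. x \<noteq> y \<and> x + y = 2)"
      using attained[of 2] by simp
    ultimately obtain x y where "x \<in> S" "y \<in> S" "x \<noteq> y" "x + y = 2" by blast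
    then show False using pos[of x] pos[of y] by linarith
  qed
  \<comment> \<open>The alternative 11 would give 11 + 2 > 12, and two distinct weights with sum 4
    would include 3 = 1 + 2, which \<open>no_sum\<close> forbids.\<close>
  have 4: "4 \<in> S"
  proof (rule ccontr)
    assume "4 \<notin> S"
    moreover have "11 \<notin> S" using le_12[of 11 2] 2 by auto
    moreover have "4 \<in> S \<or> 11 \<in> S \<or> (\<exists>x\<in>S. \<exists>y\<in>S. x \<noteq> y \<and> x + y = 4)"
      using attained[of 4] by simp
    ultimately obtain x y where xy: "x \<in> S" "y \<in> S" "x \<noteq> y" "x + y = 4" by blast
    then have "x = 3 \<or> y = 3" using pos[of x] pos[of y] by linarith
    then have "3 \<in> S" using xy by blast
    moreover have "1 + 2 \<notin> S" using no_sum[of 1 2] 1 2 by simp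
    ultimately show False by (simp add: numeral_3_eq_3)
  qed
  have "card (S - {1, 2, 4}) = 1" using fin 1 2 4 assms(1) by (simp add: card_Diff_subset)
  then obtain d where d: "S - {1, 2, 4} = {d}" by (auto simp: card_1_singleton_iff)
  have S: "S = {1, 2, 4, d}" using d 1 2 4 by blast
  moreover have "d \<notin> {1, 2, 4}" using d by blast
  ultimately have "d = 8" using assms(2) by auto
  then show ?thesis using S by simp
qed

text \<open>The cases are the Hamming distances 0 to 4. Distances 3 and 4 are written as
  complements, where the antipodal condition gives the label.\<close>

lemma vertex_cases:
  fixes x y :: "4 \<Rightarrow> bool"
  obtains "y = x" | i where "y = flip i x" | i j where "i \<noteq> j" "y = flip i (flip j x)"
    | i where "y = (\<lambda>k. \<not> flip i x k)" | "y = (\<lambda>k. \<not> x k)"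
proof -
  define d where "d k = (x k \<noteq> y k)" for k
  have "(\<forall>k. \<not> d k) \<or> (\<exists>i. \<forall>k. d k = (i = k)) \<or> (\<exists>i j. i \<noteq> j \<and> (\<forall>k. d k = ((i = k) \<noteq> (j = k))))
      \<or> (\<exists>i. \<forall>k. d k = (i \<noteq> k)) \<or> (\<forall>k. d k)"
    unfolding all_4 ex_4 by (cases "d 0"; cases "d 1"; cases "d 2"; cases "d 3"; simp)
  then consider "\<forall>k. \<not> d k" | i where "\<forall>k. d k = (i = k)"
    | i j where "i \<noteq> j" "\<forall>k. d k = ((i = k) \<noteq> (j = k))"
    | i where "\<forall>k. d k = (i \<noteq> k)" | "\<forall>k. d k"
    by blast
  then show ?thesis
  proof cases
    case 1
    then show ?thesis using that(1) by (simp add: d_def fun_eq_iff)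
  next
    case (2 i)
    then have "y = flip i x" unfolding d_def fun_eq_iff flip_apply by blast
    then show ?thesis by (rule that(2))
  next
    case (3 i j)
    then have "y = flip i (flip j x)" unfolding d_def fun_eq_iff flip_apply by blast
    then show ?thesis using that(3) 3(1) by blast
  next
    case (4 i)
    then have "y = (\<lambda>k. \<not> flip i x k)" unfolding d_def fun_eq_iff flip_apply by blast
    then show ?thesis by (rule that(4))
  next
    case 5
    then have "y = (\<lambda>k. \<not> x k)" unfolding d_def fun_eq_iff by blast
    then show ?thesis by (rule that(5))
  qed
qed

text \<open>The values other than 1 and the \<open>16 - p\<^sub>i\<close> are \<open>1 + p\<^sub>i\<close> opposite the neighbours, \<open>1 + p\<^sub>i + p\<^sub>j\<close> at
  distance two, and 16.\<close>

lemma balanced_weights: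
  assumes f: "balanced f" and bij: "bij_betw f UNIV {1..16}"
  obtains x \<pi> where "f x = 1" "bij \<pi>" "\<And>i. f (flip (\<pi> i) x) = quad 15 14 12 8 i"
proof -
  have f_eq: "f u = f v \<longleftrightarrow> u = v" for u v
    using bij by (auto simp: bij_betw_def dest: injD)
  have range_f: "f u \<in> {1..16}" for u using bij by (auto simp: bij_betw_def)
  have surj_f: "\<exists>u. f u = v" if "v \<in> {1..16}" for v
    using bij that by (metis bij_betw_imp_surj_on imageE)
  obtain x where x: "f x = 1" using surj_f[of 1] by auto
  \<comment> \<open>The subtraction is exact since labels are at most 16.\<close>
  define p where "p i = 16 - f (flip i x)" for i
  have f1: "f (flip i x) + p i = 16" for i
    using range_f[of "flip i x"] by (simp add: p_def)
  have p_eq: "p i = p j \<longleftrightarrow> i = j" for i j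
    using f1[of i] f1[of j] f_eq[of "flip i x" "flip j x"] by auto
  have f4: "f (\<lambda>k. \<not> x k) = 16" using balanced_antipodeD[OF f, of x] x by simp
  have f3: "f (\<lambda>k. \<not> flip i x k) = p i + 1" for i
    using balanced_antipodeD[OF f, of "flip i x"] f1[of i] by simp
  have f2: "f (flip i (flip j x)) = p i + p j + 1" if "i \<noteq> j" for i j
    using balanced_faceD[OF f that, of x] f1[of i] f1[of j] x by simp
  \<comment> \<open>The label 16 is taken by the antipode of \<open>x\<close>, which is not a
    neighbour, so every weight is positive.\<close>
  have "(\<lambda>k. \<not> x k) \<noteq> flip i x" for i
  proof -
    have "\<forall>i :: 4. \<exists>k. k \<noteq> i" unfolding all_4 ex_4 by simp
    then obtain k where "k \<noteq> i" by blast
    then have "flip i x k = x k" by (simp add: flip_apply)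
    then show ?thesis by (metis (full_types))
  qed
  then have p_pos: "p i \<noteq> 0" for i
    using f1[of i] f4 f_eq[of "\<lambda>k. \<not> x k" "flip i x"] by simp
  \<comment> \<open>Complementary pairs of directions lead to antipodal vertices, whose labels
    \<open>p 2 + p 3 + 1\<close> and \<open>p 0 + p 1 + 1\<close> add up to 17.\<close>
  have "(\<lambda>k. \<not> flip 2 (flip 3 x) k) = flip 0 (flip 1 x)"
    unfolding fun_eq_iff all_4 flip_apply by simp
  then have p_sum: "p 0 + p 1 + p 2 + p 3 = 15"
    using balanced_antipodeD[OF f, of "flip 2 (flip 3 x)"] f2[of 2 3] f2[of 0 1] by simp
  have "range p = {1, 2, 4, 8}"
  proof (rule distinct_subset_sums)
    have inj: "inj p" using p_eq by (auto simp: inj_def)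
    then show "card (range p) = 4" by (simp add: card_image)
    have "\<Sum>(range p) = (\<Sum>i\<in>UNIV. p i)" by (simp add: sum.reindex[OF inj])
    also have "\<dots> = 15" using p_sum by (simp only: sum_4)
    finally show "\<Sum>(range p) = 15" .
    show "0 \<notin> range p"
    proof
      assume "0 \<in> range p"
      then obtain i where "0 = p i" by (rule rangeE)
      then show False using p_pos[of i] by simp
    qed
    show "u + v \<notin> range p" if uv: "u \<in> range p" "v \<in> range p" "u \<noteq> v" for u v
    proof
      assume "u + v \<in> range p"
      then obtain i j k where ijk: "u = p i" "v = p j" "p i + p j = p k"
        using uv(1,2) by auto
      then have "i \<noteq> j" using uv(3) by auto
      \<comment> \<open>Vertices at distances two and three from \<open>x\<close> would share a
        label. In a coordinate \<open>l\<close> outside \<open>i\<close>, \<open>j\<close>,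
        \<open>k\<close> the first agrees with \<open>x\<close> and the second does not.\<close>
      then have "f (flip i (flip j x)) = f (\<lambda>l. \<not> flip k x l)"
        using f2[of i j] f3[of k] ijk(3) by simp
      then have "flip i (flip j x) = (\<lambda>l. \<not> flip k x l)"
        by (simp only: f_eq)
      then have flips: "flip i (flip j x) l = (\<not> flip k x l)" for l
        by (rule fun_cong)
      have *: "((i = l) = (j = l)) = (k = l)" for l
        using flips[of l] unfolding flip_apply by sat
      have "\<forall>i j k :: 4. \<exists>l. l \<notin> {i, j, k}"
        unfolding all_4 ex_4 by simp
      then obtain l where "l \<notin> {i, j, k}" by blast
      then show False using *[of l] by auto
    qed
    show "v \<in> range p \<or> 15 - v \<in> range p \<or> (\<exists>a\<in>range p. \<exists>b\<in>range p. a \<noteq> b \<and> a + b = v)"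
      if v: "v \<in> {1, 2, 4}" for v
    proof -
      \<comment> \<open>The distance from \<open>x\<close> of the vertex labelled
        \<open>v + 1\<close> decides the alternative: 1 gives \<open>15 - v\<close>, 2 a sum of two
        weights, 3 a single weight; 0 and 4 carry the labels 1 and 16.\<close>
      obtain y where y: "f y = v + 1" using surj_f[of "v + 1"] v by auto
      show ?thesis
      proof (cases rule: vertex_cases[of y x])
        case 1
        then show ?thesis using x y v by auto
      next
        case (2 i)
        then have "15 - v = p i" using f1[of i] y by simp
        then show ?thesis by blast
      next
        case (3 i j)
        then have "p i \<noteq> p j" "p i + p j = v" using f2[of i j] y p_eq by auto
        then show ?thesis by blast
      next
        case (4 i)
        then show ?thesis using f3[of i] y by auto
      next
        case 5
        then show ?thesis using f4 y v by auto
      qed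
    qed
  qed
  \<comment> \<open>Ordering the directions by weights 1, 2, 4, 8 turns the neighbour labels
    \<open>16 - p i\<close> into 15, 14, 12, 8.\<close>
  then have "quad 1 2 4 8 i \<in> range p" for i by (simp add: quad_def)
  then have "\<forall>i. \<exists>j. p j = quad 1 2 4 8 i" by (metis imageE)
  then obtain \<pi> where \<pi>: "\<And>i. p (\<pi> i) = quad 1 2 4 8 i" by metis
  have "inj \<pi>"
  proof (rule injI)
    fix i j assume "\<pi> i = \<pi> j"
    then have "quad 1 2 4 8 i = (quad 1 2 4 8 j :: nat)" using \<pi> by metis
    moreover have "\<forall>i j. quad 1 2 4 8 i = (quad 1 2 4 8 j :: nat) \<longrightarrow> i = j"
      unfolding all_4 by (simp add: quad_def)
    ultimately show "i = j" by blast
  qed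
  then have "bij \<pi>" by (simp add: bij_def finite_UNIV_inj_surj)
  moreover have "f (flip (\<pi> i) x) = quad 15 14 12 8 i" for i
    using f1[of "\<pi> i"] \<pi>[of i] by (auto simp: quad_def split: if_splits)
  ultimately show ?thesis using x that by blast
qed

text \<open>Automorphisms move both labellings to a normal form with 1 at the origin and 15, 14, 12,
  8 at its neighbours; by \<open>balanced_eqI\<close> the two normal forms coincide.\<close>

lemma balanced_transitive:
  assumes f: "balanced f" "bij_betw f UNIV {1..16}"
    and f': "balanced f'" "bij_betw f' UNIV {1..16}"
  obtains g where "g \<in> graph_isos Q4 Q4" "f = f' \<circ> g"
proof -
  have normalise: "\<exists>g \<in> graph_isos Q4 Q4. balanced (f \<circ> g) \<and> (f \<circ> g) (\<lambda>i. False) = 1 \<and>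
      (\<forall>i. (f \<circ> g) (flip i (\<lambda>i. False)) = quad 15 14 12 8 i)"
    if f: "balanced f" "bij_betw f UNIV {1..16}" for f
  proof -
    obtain x \<pi> where x: "f x = 1" and \<pi>: "bij \<pi>" "\<And>i. f (flip (\<pi> i) x) = quad 15 14 12 8 i"
      by (rule balanced_weights[OF f]) (rule that)
    \<comment> \<open>Chosen so that the origin goes to the vertex labelled 1 and direction
      \<open>i\<close> to direction \<open>\<pi> i\<close>.\<close>
    define g where "g y j = (y (inv' \<pi> j) \<noteq> x j)" for y :: "4 \<Rightarrow> bool" and j
    have g: "g y (\<pi> i) = (y i \<noteq> x (\<pi> i))" for y i
      using \<pi>(1) by (simp add: g_def bij_is_inj)
    have aut: "g \<in> graph_isos Q4 Q4" using \<pi>(1) g by (rule aut_Q4I)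
    have g0: "g (\<lambda>i. False) = x" unfolding g_def by simp
    have "g (flip i (\<lambda>i. False)) = flip (\<pi> i) x" for i
      using flip_equivariant[of \<pi> g "\<lambda>i. x (\<pi> i)" i "\<lambda>i. False"] \<pi>(1) g g0 by simp
    then show ?thesis
      using aut x g0 \<pi>(2) balanced_aut[OF f(1) aut] by (intro bexI[of _ g]) simp_all
  qed
  obtain g where g: "g \<in> graph_isos Q4 Q4" "balanced (f \<circ> g)" "(f \<circ> g) (\<lambda>i. False) = 1"
      "\<And>i. (f \<circ> g) (flip i (\<lambda>i. False)) = quad 15 14 12 8 i"
    using normalise[OF f] by blast
  obtain g' where g': "g' \<in> graph_isos Q4 Q4" "balanced (f' \<circ> g')" "(f' \<circ> g') (\<lambda>i. False) = 1"
      "\<And>i. (f' \<circ> g') (flip i (\<lambda>i. False)) = quad 15 14 12 8 i"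
    using normalise[OF f'] by blast
  have eq: "f \<circ> g = f' \<circ> g'"
    by (rule balanced_eqI) (use g g' in simp_all)
  have "g' \<circ> inv' g \<in> graph_isos Q4 Q4"
    using g(1) g'(1) graph_isos_comp graph_isos_inv by blast
  moreover have "f = f' \<circ> (g' \<circ> inv' g)"
    using eq g(1) by (metis comp_assoc comp_id surj_iff bij_is_surj graph_isosD(1))
  ultimately show ?thesis by (rule that)
qed

section \<open>The Gray code\<close>

lemma minus_4: "j - 1 = j + 3" "j - 2 = j + 2" "j - 3 = j + 1" for j :: 4
  by (simp_all add: diff_eq_eq add.assoc)

text \<open>The cyclic Gray code 00, 10, 11, 01 of an index, with the row in coordinates 0, 1 and
  the column in coordinates 2, 3.\<close>

definition gray :: "4 \<times> 4 \<Rightarrow> 4 \<Rightarrow> bool"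
  where "gray = (\<lambda>(i, j). quad (i = 1 \<or> i = 2) (i = 2 \<or> i = 3) (j = 1 \<or> j = 2) (j = 2 \<or> j = 3))"

definition gray_inv :: "(4 \<Rightarrow> bool) \<Rightarrow> 4 \<times> 4"
  where "gray_inv x =
    (if x 0 then if x 1 then 2 else 1 else if x 1 then 3 else 0,
     if x 2 then if x 3 then 2 else 1 else if x 3 then 3 else 0)"

lemma quad_simps [simp]: "quad a b c d 0 = a" "quad a b c d 1 = b" "quad a b c d 2 = c" "quad a b c d 3 = d"
  by (simp_all add: quad_def)

lemma gray_inv_gray [simp]: "gray_inv (gray p) = p"
proof -
  have "\<forall>i j. gray_inv (gray (i, j)) = (i, j)"
    unfolding all_4 by (simp add: gray_def gray_inv_def)
  then show ?thesis by (cases p) simp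
qed

lemma gray_gray_inv [simp]: "gray (gray_inv x) = x"
  unfolding fun_eq_iff all_4
  by (cases "x 0"; cases "x 1"; cases "x 2"; cases "x 3") (simp_all add: gray_def gray_inv_def)

lemma bij_gray: "bij gray"
  by (rule bij_betw_byWitness[where f' = gray_inv]) simp_all

text \<open>Flipping a coordinate of the Gray code of \<open>i\<close> moves to one of the two neighbours of \<open>i\<close> on the cycle.\<close>

definition gray_step :: "4 \<Rightarrow> 4 \<times> 4 \<Rightarrow> 4 \<times> 4"
  where "gray_step k = (\<lambda>(i, j). quad (quad 1 0 3 2 i, j) (3 - i, j) (i, quad 1 0 3 2 j) (i, 3 - j) k)"

text \<open>The 4-cycle is the union of two matchings: \<open>quad 1 0 3 2\<close> exchanges 0 with
  1 and 2 with 3, and \<open>3 - i\<close> exchanges 0 with 3 and 1 with 2. The former flips the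
  first Gray bit, the latter the second.\<close>

lemma C4_iff: "C4 i k \<longleftrightarrow> k = quad 1 0 3 2 i \<or> k = 3 - i"
proof -
  have "\<forall>i k. C4 i k \<longleftrightarrow> k = quad 1 0 3 2 i \<or> k = 3 - i"
    unfolding all_4 C4_def by simp
  then show ?thesis by blast
qed

lemma C4xC4_iff: "C4xC4 p q \<longleftrightarrow> (\<exists>k. q = gray_step k p)"
  by (cases p; cases q) (auto simp: C4xC4_def cartesian_graph_product_def C4_iff ex_4 gray_step_def)

lemma gray_neighbours:
  "quad 1 0 3 2 i = (1::4) \<or> quad 1 0 3 2 i = (2::4) \<longleftrightarrow> \<not> (i = 1 \<or> i = (2::4))"
  "quad 1 0 3 2 i = (2::4) \<or> quad 1 0 3 2 i = (3::4) \<longleftrightarrow> i = 2 \<or> i = (3::4)"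
  "3 - i = 1 \<or> 3 - i = 2 \<longleftrightarrow> i = 1 \<or> i = (2::4)"
  "3 - i = 2 \<or> 3 - i = 3 \<longleftrightarrow> \<not> (i = 2 \<or> i = (3::4))"
  by (cases i rule: cases_4; simp)+

lemma flip_gray: "flip k (gray p) = gray (gray_step k p)"
  by (cases p; cases k rule: cases_4)
    (simp_all only: fun_eq_iff all_4 flip_apply gray_def gray_step_def quad_simps prod.case
      gray_neighbours distinct_4 simp_thms)

lemma gray_graph_iso: "gray \<in> graph_isos C4xC4 Q4"
proof -
  have "inj gray" using bij_gray by (rule bij_is_inj)
  then show ?thesis
    using bij_gray by (simp add: graph_isos_def Q4_iff_flip C4xC4_iff flip_gray inj_eq)
qed

lemma gray_opposite:
  "i + 2 = 1 \<or> i + 2 = 2 \<longleftrightarrow> \<not> (i = 1 \<or> i = (2::4))"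
  "i + 2 = 2 \<or> i + 2 = 3 \<longleftrightarrow> \<not> (i = 2 \<or> i = (3::4))"
  by (cases i rule: cases_4; simp)+

text \<open>Two steps along a 4-cycle flip both bits of its Gray code.\<close>

lemma Not_gray: "(\<lambda>k. \<not> gray (i, j) k) = gray (i + 2, j + 2)"
  unfolding fun_eq_iff all_4 by (simp only: gray_def quad_simps prod.case gray_opposite simp_thms)

lemma all_gray: "(\<forall>x. P x) \<longleftrightarrow> (\<forall>i j. P (gray (i, j)))"
  using bij_gray by (metis bij_pointE surj_pair)

lemma balanced_gray_iff: "balanced (M \<circ> gray_inv) \<longleftrightarrow>
    (\<forall>i j k l. k \<noteq> l \<longrightarrow>
      M (i, j) + M (gray_step k (i, j)) + M (gray_step l (i, j)) + M (gray_step k (gray_step l (i, j))) = 34) \<and>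
    (\<forall>i j. M (i, j) + M (i + 2, j + 2) = 17)"
  unfolding balanced_def all_gray comp_def flip_gray Not_gray gray_inv_gray by (rule refl)

text \<open>Faces in directions 0, 1 are columns, in directions 2, 3 rows, and in mixed directions
  \<open>2 \<times> 2\<close> blocks.\<close>

lemma most_perfect_iff:
  "M \<in> most_perfect_squares \<longleftrightarrow> M \<in> arrangements \<and> balanced (M \<circ> gray_inv)"
proof -
  have "balanced (M \<circ> gray_inv) \<longleftrightarrow>
    (\<forall>i. (\<Sum>j\<in>UNIV. M (i, j)) = 34) \<and>
    (\<forall>j. (\<Sum>i\<in>UNIV. M (i, j)) = 34) \<and>
    (\<forall>i j. M (i, j) + M (i, j + 1) + M (i + 1, j) + M (i + 1, j + 1) = 34) \<and>
    (\<forall>d. (\<Sum>i\<in>UNIV. M (i, d + i)) = 34) \<and>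
    (\<forall>d. (\<Sum>i\<in>UNIV. M (i, d - i)) = 34)" (is "_ \<longleftrightarrow> ?R")
  proof
    assume ?R
    then have row: "M (i, 0) + M (i, 1) + M (i, 2) + M (i, 3) = 34"
      and column: "M (0, j) + M (1, j) + M (2, j) + M (3, j) = 34"
      and block: "M (i, j) + M (i, j + 1) + M (i + 1, j) + M (i + 1, j + 1) = 34"
      and diagonal: "M (0, d) + M (1, d + 1) + M (2, d + 2) + M (3, d + 3) = 34"
      and antidiagonal: "M (0, d) + M (1, d - 1) + M (2, d - 2) + M (3, d - 3) = 34" for i j d
      unfolding sum_4 by simp_all
    \<comment> \<open>An index, its images under the two matchings and their composite run through
      the whole cycle.\<close>
    have row': "M (i, j) + M (i, quad 1 0 3 2 j) + M (i, 3 - j) + M (i, quad 1 0 3 2 (3 - j)) = 34" for i j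
      using row[of i] by (cases j rule: cases_4; simp)
    have column': "M (i, j) + M (quad 1 0 3 2 i, j) + M (3 - i, j) + M (quad 1 0 3 2 (3 - i), j) = 34" for i j
      using column[of j] by (cases i rule: cases_4; simp)
    have commute: "3 - quad 1 0 3 2 i = (quad 1 0 3 2 (3 - i) :: 4)" for i
      by (cases i rule: cases_4; simp)
    \<comment> \<open>A neighbour may lie on either side, so \<open>(i, j)\<close> can be any corner
      of the block.\<close>
    have block': "M (i, j) + M (i', j) + M (i, j') + M (i', j') = 34" if "C4 i i'" "C4 j j'" for i i' j j'
      using that block[of i j] block[of i' j] block[of i j'] block[of i' j']
      by (auto simp: C4_def)
    have nbr: "C4 i (quad 1 0 3 2 i)" "C4 i (3 - i)" for i by (simp_all add: C4_iff)
    note blocks = block'[OF nbr(1) nbr(1)] block'[OF nbr(1) nbr(2)] block'[OF nbr(2) nbr(1)]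
      block'[OF nbr(2) nbr(2)]
    have face: "M (i, j) + M (gray_step k (i, j)) + M (gray_step l (i, j))
        + M (gray_step k (gray_step l (i, j))) = 34" if "k \<noteq> l" for i j k l
      using that row'[of i j] column'[of i j] blocks[of i j]
      by (cases k rule: cases_4; cases l rule: cases_4; simp add: gray_step_def commute)
    have antipode: "M (i, j) + M (i + 2, j + 2) = 17" for i j
    proof -
      have "M (i, j) + M (i, j + 1) + M (i, j + 2) + M (i, j + 3) = 34" for i j
        using row[of i] by (cases j rule: cases_4; simp)
      note row'' = this[of "i + 2" j]
      have "M (i, j) + M (i + 1, j) + M (i + 2, j) + M (i + 3, j) = 34" for i j
        using column[of j] by (cases i rule: cases_4; simp)
      note column'' = this[of i "j + 3"]
      \<comment> \<open>Adding the first two of these equations and subtracting the third leaves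
        twice the antipodal sum equal to 34. The last two combine a row or column with two
        overlapping blocks, whose outer halves have equal sums.\<close>
      have "M (i, j) + M (i + 1, j + 1) + M (i + 2, j + 2) + M (i + 3, j + 3) = 34"
        using diagonal[of "j - i"] by (cases i rule: cases_4; simp add: minus_4 add.assoc)
      moreover have "M (i, j) + M (i, j + 1) + (M (i + 2, j + 2) + M (i + 2, j + 3)) = 34"
        using block[of i j] block[of "i + 1" j] row'' by (simp add: add.assoc)
      moreover have "M (i, j + 1) + M (i + 1, j + 1) + (M (i + 2, j + 3) + M (i + 3, j + 3)) = 34"
        using block[of i "j + 1"] block[of i "j + 2"] column'' by (simp add: add.assoc)
      ultimately show ?thesis by simp
    qed
    show "balanced (M \<circ> gray_inv)"
      unfolding balanced_gray_iff using face antipode by blast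
  next
    \<comment> \<open>Conversely, a diagonal of either direction consists of two antipodal pairs;
      the other sums are faces.\<close>
    assume "balanced (M \<circ> gray_inv)"
    then show ?R
      unfolding balanced_gray_iff all_4 sum_4 gray_step_def by simp
  qed
  then show ?thesis unfolding most_perfect_squares_def by blast
qed

section \<open>Actions of automorphism groups\<close>

lemma graph_iso_conj:
  assumes "\<phi> \<in> graph_isos E F"
  shows "(\<lambda>g. \<phi> \<circ> g \<circ> inv' \<phi>) \<in> iso (graph_aut E) (graph_aut F)"
proof -
  have bij: "bij \<phi>" using assms by (rule graph_isosD)
  have cancel: "\<phi> \<circ> inv' \<phi> = id" "inv' \<phi> \<circ> \<phi> = id"
    using bij by (simp_all add: bij_is_inj surj_iff[THEN iffD1] bij_is_surj)
  have cancel': "\<phi> (inv' \<phi> x) = x" "inv' \<phi> (\<phi> y) = y" for x y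
    using bij by (simp_all add: bij_is_inj bij_is_surj surj_f_inv_f)
  show ?thesis
    unfolding iso_def
  proof (intro CollectI conjI homI)
    show closed: "\<phi> \<circ> g \<circ> inv' \<phi> \<in> carrier (graph_aut F)" if "g \<in> carrier (graph_aut E)" for g
      using graph_isos_comp[OF graph_isos_inv[OF assms] graph_isos_comp[OF _ assms]] that
      by (simp add: graph_aut_def)
    show "\<phi> \<circ> (g \<otimes>\<^bsub>graph_aut E\<^esub> h) \<circ> inv' \<phi>
        = (\<phi> \<circ> g \<circ> inv' \<phi>) \<otimes>\<^bsub>graph_aut F\<^esub> (\<phi> \<circ> h \<circ> inv' \<phi>)" for g h
      by (simp add: graph_aut_def fun_eq_iff cancel')
    show "bij_betw (\<lambda>g. \<phi> \<circ> g \<circ> inv' \<phi>) (carrier (graph_aut E)) (carrier (graph_aut F))"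
    proof (rule bij_betw_byWitness[where f' = "\<lambda>h. inv' \<phi> \<circ> h \<circ> \<phi>"])
      show "(\<lambda>h. inv' \<phi> \<circ> h \<circ> \<phi>) ` carrier (graph_aut F) \<subseteq> carrier (graph_aut E)"
        using graph_isos_comp[OF assms graph_isos_comp[OF _ graph_isos_inv[OF assms]]]
        by (auto simp: graph_aut_def comp_assoc)
    qed (use closed in \<open>auto simp: fun_eq_iff cancel'\<close>)
  qed
qed

lemma faithful_action_iso:
  assumes "faithful_action H S \<alpha>" "group G" "\<psi> \<in> iso G H"
  shows "faithful_action G S (\<lambda>g. \<alpha> (\<psi> g))"
proof -
  interpret H: faithful_action H S \<alpha> by fact
  interpret G: group G by fact
  have \<psi>: "\<psi> \<in> hom G H" "bij_betw \<psi> (carrier G) (carrier H)"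
    using assms(3) by (auto simp: iso_def)
  have "(\<lambda>g. \<alpha> (\<psi> g)) \<in> hom G (BijGroup S)"
    using hom_compose[OF \<psi>(1) group_hom.homh[OF H.group_hom]] by (simp add: comp_def)
  then have "group_hom G (BijGroup S) (\<lambda>g. \<alpha> (\<psi> g))"
    by (simp add: group_hom_def group_hom_axioms_def group_BijGroup G.is_group)
  moreover have "inj_on (\<lambda>g. \<alpha> (\<psi> g)) (carrier G)"
    using comp_inj_on[of \<psi> "carrier G" \<alpha>] \<psi>(2) H.faithful by (simp add: bij_betw_def comp_def)
  ultimately show ?thesis
    by (simp add: faithful_action_def group_action_def faithful_action_axioms_def)
qed

lemma position_action_apply: "M \<in> S \<Longrightarrow> position_action S g M = M \<circ> inv' g"
  by (simp add: position_action_def)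

text \<open>Faithfulness rests on one square with distinct entries, since where its entries end up
  determines the automorphism.\<close>

lemma faithful_position_action:
  assumes S: "\<And>M g. M \<in> S \<Longrightarrow> g \<in> graph_isos E E \<Longrightarrow> M \<circ> g \<in> S"
    and M\<^sub>0: "M\<^sub>0 \<in> S" "inj M\<^sub>0"
  shows "faithful_action (graph_aut E) S (position_action S)"
proof -
  have inv: "M \<circ> inv' g \<in> S" if "M \<in> S" "g \<in> graph_isos E E" for M g
    using S that graph_isos_inv by blast
  have closed: "position_action S g \<in> Bij S" if g: "g \<in> graph_isos E E" for g
  proof -
    have bij: "bij g" using g by (rule graph_isosD)
    have "bij_betw (position_action S g) S S"
    proof (rule bij_betw_byWitness[where f' = "\<lambda>M. M \<circ> g"])
      show "\<forall>M\<in>S. position_action S g M \<circ> g = M"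
        using bij by (simp add: position_action_apply comp_assoc bij_is_inj)
      show "\<forall>M\<in>S. position_action S g (M \<circ> g) = M"
        using bij S g by (simp add: position_action_apply comp_assoc surj_iff[THEN iffD1] bij_is_surj)
      show "position_action S g ` S \<subseteq> S"
        using inv g by (auto simp: position_action_apply)
      show "(\<lambda>M. M \<circ> g) ` S \<subseteq> S" using S g by auto
    qed
    then show ?thesis by (simp add: Bij_def position_action_def)
  qed
  have "position_action S \<in> hom (graph_aut E) (BijGroup S)"
  proof (rule homI)
    fix g h assume "g \<in> carrier (graph_aut E)" "h \<in> carrier (graph_aut E)"
    then have gh: "g \<in> graph_isos E E" "h \<in> graph_isos E E" by (simp_all add: graph_aut_def)
    \<comment> \<open>Precomposition reverses products and inversion reverses them back, so the
      action is a homomorphism.\<close>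
    have "position_action S (g \<circ> h) M = compose S (position_action S g) (position_action S h) M" for M
      using gh inv o_inv_distrib[of g h] graph_isosD(1)[OF gh(1)] graph_isosD(1)[OF gh(2)]
      by (simp add: position_action_def compose_def comp_assoc)
    then show "position_action S (g \<otimes>\<^bsub>graph_aut E\<^esub> h) =
        position_action S g \<otimes>\<^bsub>BijGroup S\<^esub> position_action S h"
      using gh closed by (simp add: graph_aut_def BijGroup_def fun_eq_iff)
  qed (simp add: graph_aut_def BijGroup_def closed)
  then have "group_hom (graph_aut E) (BijGroup S) (position_action S)"
    by (simp add: group_hom_def group_hom_axioms_def group_BijGroup group_graph_aut)
  moreover have "inj_on (position_action S) (carrier (graph_aut E))"
  proof (rule inj_onI)
    fix g h assume "g \<in> carrier (graph_aut E)" "h \<in> carrier (graph_aut E)"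
      and eq: "position_action S g = position_action S h"
    then have bij: "bij g" "bij h" by (simp_all add: graph_aut_def graph_isos_def)
    have "M\<^sub>0 \<circ> inv' g = M\<^sub>0 \<circ> inv' h"
      using fun_cong[OF eq, of M\<^sub>0] M\<^sub>0(1) by (simp add: position_action_apply)
    then have "inv' g = inv' h" using M\<^sub>0(2) by (metis fun.inj_map injD)
    then show "g = h" using bij by (metis inv_inv_eq)
  qed
  ultimately show ?thesis
    by (simp add: faithful_action_def group_action_def faithful_action_axioms_def)
qed

lemma orbit_position_action:
  assumes "M \<in> S"
  shows "orbit (graph_aut E) (position_action S) M = {M \<circ> g | g. g \<in> graph_isos E E}"
proof -
  have "{M \<circ> inv' g | g. g \<in> graph_isos E E} = {M \<circ> g | g. g \<in> graph_isos E E}"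
  proof (intro subset_antisym subsetI)
    fix N assume "N \<in> {M \<circ> g | g. g \<in> graph_isos E E}"
    then obtain g where g: "g \<in> graph_isos E E" "N = M \<circ> g" by blast
    then have "N = M \<circ> inv' (inv' g)" by (simp add: graph_isosD(1) inv_inv_eq)
    then show "N \<in> {M \<circ> inv' g | g. g \<in> graph_isos E E}" using graph_isos_inv[OF g(1)] by blast
  qed (use graph_isos_inv in blast)
  then show ?thesis
    using assms by (simp add: orbit_def position_action_apply graph_aut_def)
qed

lemma orbit_eq_image: "orbit G \<alpha> x = (\<lambda>g. \<alpha> g x) ` carrier G"
  unfolding orbit_def by blast

section \<open>The hyperoctahedral group\<close>

lemma carrier_C2_power: "carrier (C2_power n) = {1..n} \<rightarrow>\<^sub>E {0, 1}"
proof -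
  have "{0..<2} = {0, 1 :: int}" by auto
  then show ?thesis by (simp add: C2_power_def carrier_integer_mod_group)
qed

lemma mult_C2_power: "v \<otimes>\<^bsub>C2_power n\<^esub> w = (\<lambda>i\<in>{1..n}. (v i + w i) mod 2)"
  by (simp add: C2_power_def)

lemma C2_power_apply:
  assumes "v \<in> carrier (C2_power n)" "i \<in> {1..n}"
  shows "v i = 0 \<or> v i = 1"
proof -
  have "v i \<in> {0, 1}" using assms unfolding carrier_C2_power by (rule PiE_mem)
  then show ?thesis by simp
qed

text \<open>Sign vectors are handled through the predicate \<open>v i = 1\<close>, under which
  addition modulo 2 becomes exclusive or, as for vertices of the cube.\<close>

lemma mult_C2_power_apply:
  assumes "v \<in> carrier (C2_power n)" "w \<in> carrier (C2_power n)" "i \<in> {1..n}"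
  shows "(v \<otimes>\<^bsub>C2_power n\<^esub> w) i = 1 \<longleftrightarrow> (v i = 1) \<noteq> (w i = 1)"
  using C2_power_apply[OF assms(1,3)] C2_power_apply[OF assms(2,3)] assms(3)
  by (auto simp: mult_C2_power)

lemma C2_power_eqI:
  assumes "v \<in> carrier (C2_power n)" "w \<in> carrier (C2_power n)"
    and "\<And>i. i \<in> {1..n} \<Longrightarrow> v i = 1 \<longleftrightarrow> w i = 1"
  shows "v = w"
proof (rule PiE_ext[of v "{1..n}" _ w])
  show "v \<in> {1..n} \<rightarrow>\<^sub>E {0, 1}" "w \<in> {1..n} \<rightarrow>\<^sub>E {0, 1}"
    using assms(1,2) by (simp_all add: carrier_C2_power)
  show "v i = w i" if "i \<in> {1..n}" for i
    using C2_power_apply[OF assms(1) that] C2_power_apply[OF assms(2) that] assms(3)[OF that] by auto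
qed

lemma permutes_inv_in:
  assumes "\<sigma> permutes S" "i \<in> S"
  shows "inv' \<sigma> i \<in> S"
  using assms permutes_in_image[OF permutes_inv[OF assms(1)]] by blast

lemma permute_coords_closed:
  assumes "\<sigma> permutes {1..n}" "v \<in> carrier (C2_power n)"
  shows "permute_coords n \<sigma> v \<in> carrier (C2_power n)"
  unfolding permute_coords_def carrier_C2_power restrict_PiE_iff
  using PiE_mem[OF assms(2)[unfolded carrier_C2_power]] permutes_inv_in[OF assms(1)] by blast

lemma permute_coords_apply:
  assumes "\<sigma> permutes {1..n}" "i \<in> {1..n}"
  shows "permute_coords n \<sigma> v (\<sigma> i) = v i"
  using assms permutes_in_image[OF assms(1), of i] by (simp add: permute_coords_def permutes_inverses)

text \<open>The inverse permutation in \<open>permute_coords\<close> makes it a left action, as the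
  semidirect product requires.\<close>

lemma group_hyperoctahedral:
  "group (semidirect_product (C2_power n) (sym_group n) (permute_coords n))"
proof (rule group_semidirect_product)
  show "group (C2_power n)" by (simp add: C2_power_def)
  show "group (sym_group n)" by (rule sym_group_is_group)
  show "permute_coords n \<sigma> \<in> hom (C2_power n) (C2_power n)" if "\<sigma> \<in> carrier (sym_group n)" for \<sigma>
  proof (rule homI)
    have \<sigma>: "\<sigma> permutes {1..n}" using that by (simp add: sym_group_def)
    show "permute_coords n \<sigma> v \<in> carrier (C2_power n)" if "v \<in> carrier (C2_power n)" for v
      using \<sigma> that by (rule permute_coords_closed)
    show "permute_coords n \<sigma> (v \<otimes>\<^bsub>C2_power n\<^esub> w)
        = permute_coords n \<sigma> v \<otimes>\<^bsub>C2_power n\<^esub> permute_coords n \<sigma> w" for v w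
      using permutes_inv_in[OF \<sigma>] by (auto simp: mult_C2_power permute_coords_def fun_eq_iff)
  qed
  show "permute_coords n \<one>\<^bsub>sym_group n\<^esub> v = v" if "v \<in> carrier (C2_power n)" for v
    using that by (auto simp: sym_group_def permute_coords_def carrier_C2_power fun_eq_iff PiE_def extensional_def)
  show "permute_coords n (\<sigma> \<otimes>\<^bsub>sym_group n\<^esub> \<tau>) v = permute_coords n \<sigma> (permute_coords n \<tau> v)"
    if "\<sigma> \<in> carrier (sym_group n)" "\<tau> \<in> carrier (sym_group n)" for \<sigma> \<tau> v
    using that permutes_inv_in[of \<sigma> "{1..n}"]
    by (auto simp: sym_group_def permute_coords_def fun_eq_iff o_inv_distrib permutes_bij)
qed

section \<open>Signed permutations as pairs of a sign vector and a permutation\<close>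

lemma signed_range_iff: "k \<in> {- int n..int n} - {0} \<longleftrightarrow> nat \<bar>k\<bar> \<in> {1..n}"
  by (simp add: Suc_le_eq nat_le_iff abs_le_iff) linarith

text \<open>The absolute value is permuted first and the sign is read from \<open>v\<close> at the
  target, since \<open>(v, \<sigma>)\<close> in the semidirect product means \<open>\<sigma>\<close>
  followed by \<open>v\<close>. Outside the range the map is the identity, as
  \<open>permutes\<close> demands.\<close>

definition signed_permutation :: "nat \<Rightarrow> (nat \<Rightarrow> int) \<Rightarrow> (nat \<Rightarrow> nat) \<Rightarrow> int \<Rightarrow> int"
  where "signed_permutation n v \<sigma> k = (if nat \<bar>k\<bar> \<in> {1..n}
    then sgn k * (if v (\<sigma> (nat \<bar>k\<bar>)) = 1 then - 1 else 1) * int (\<sigma> (nat \<bar>k\<bar>)) else k)"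

lemma signed_permutation_apply:
  assumes "\<sigma> permutes {1..n}" "nat \<bar>k\<bar> \<in> {1..n}"
  shows "nat \<bar>signed_permutation n v \<sigma> k\<bar> = \<sigma> (nat \<bar>k\<bar>)"
    and "sgn (signed_permutation n v \<sigma> k) = sgn k * (if v (\<sigma> (nat \<bar>k\<bar>)) = 1 then - 1 else 1)"
proof -
  have "\<sigma> (nat \<bar>k\<bar>) \<in> {1..n}" using assms by (metis permutes_in_image)
  then show "nat \<bar>signed_permutation n v \<sigma> k\<bar> = \<sigma> (nat \<bar>k\<bar>)"
    "sgn (signed_permutation n v \<sigma> k) = sgn k * (if v (\<sigma> (nat \<bar>k\<bar>)) = 1 then - 1 else 1)"
    using assms(2) by (auto simp: signed_permutation_def abs_mult sgn_mult abs_sgn_eq)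
qed

lemma sgn_nat_abs_eqI:
  fixes k l :: int
  assumes "sgn k = sgn l" "nat \<bar>k\<bar> = nat \<bar>l\<bar>"
  shows "k = l"
  using assms by (auto simp: sgn_if split: if_splits)

text \<open>Absolute value and sign are compared separately. The signs agree because
  \<open>permute_coords n \<sigma> w\<close> at \<open>\<sigma> i\<close> is \<open>w i\<close>, the
  sign contributed by the inner map.\<close>

lemma signed_permutation_mult:
  assumes \<sigma>: "\<sigma> permutes {1..n}" and \<tau>: "\<tau> permutes {1..n}"
    and v: "v \<in> carrier (C2_power n)" and w: "w \<in> carrier (C2_power n)"
  shows "signed_permutation n (v \<otimes>\<^bsub>C2_power n\<^esub> permute_coords n \<sigma> w) (\<sigma> \<circ> \<tau>)
    = signed_permutation n v \<sigma> \<circ> signed_permutation n w \<tau>"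
proof
  fix k
  let ?u = "v \<otimes>\<^bsub>C2_power n\<^esub> permute_coords n \<sigma> w"
  show "signed_permutation n ?u (\<sigma> \<circ> \<tau>) k = (signed_permutation n v \<sigma> \<circ> signed_permutation n w \<tau>) k"
  proof (cases "nat \<bar>k\<bar> \<in> {1..n}")
    case True
    let ?i = "\<tau> (nat \<bar>k\<bar>)" and ?l = "signed_permutation n w \<tau> k"
    have i: "?i \<in> {1..n}" "\<sigma> ?i \<in> {1..n}" using True \<sigma> \<tau> by (metis permutes_in_image)+
    have \<sigma>\<tau>: "\<sigma> \<circ> \<tau> permutes {1..n}" using \<sigma> \<tau> by (intro permutes_compose)
    have l: "nat \<bar>?l\<bar> \<in> {1..n}" using signed_permutation_apply(1)[OF \<tau> True] i by simp
    have u: "?u (\<sigma> ?i) = 1 \<longleftrightarrow> (v (\<sigma> ?i) = 1) \<noteq> (w ?i = 1)"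
      by (simp only: mult_C2_power_apply[OF v permute_coords_closed[OF \<sigma> w] i(2)]
        permute_coords_apply[OF \<sigma> i(1)])
    show ?thesis
    proof (rule sgn_nat_abs_eqI)
      show "sgn (signed_permutation n ?u (\<sigma> \<circ> \<tau>) k) =
          sgn ((signed_permutation n v \<sigma> \<circ> signed_permutation n w \<tau>) k)"
        using u by (simp add: signed_permutation_apply[OF \<sigma>\<tau> True] signed_permutation_apply[OF \<sigma> l]
          signed_permutation_apply[OF \<tau> True])
      show "nat \<bar>signed_permutation n ?u (\<sigma> \<circ> \<tau>) k\<bar> =
          nat \<bar>(signed_permutation n v \<sigma> \<circ> signed_permutation n w \<tau>) k\<bar>"
        by (simp add: signed_permutation_apply[OF \<sigma>\<tau> True] signed_permutation_apply[OF \<sigma> l]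
          signed_permutation_apply[OF \<tau> True])
    qed
  next
    case False
    then show ?thesis by (simp only: signed_permutation_def if_False comp_def)
  qed
qed

lemma signed_permutation_closed:
  assumes \<sigma>: "\<sigma> permutes {1..n}"
  shows "signed_permutation n v \<sigma> \<in> carrier (W_B n)"
proof -
  let ?p = "signed_permutation n v \<sigma>" and ?S = "{- int n..int n} - {0}"
  note S = signed_range_iff[of _ n]
  have image: "?p k \<in> ?S" if "k \<in> ?S" for k
    using that signed_permutation_apply(1)[OF \<sigma>, of k v] permutes_in_image[OF \<sigma>, of "nat \<bar>k\<bar>"]
    unfolding S by simp
  have "inj_on ?p ?S"
  proof (rule inj_onI)
    fix k l assume "k \<in> ?S" "l \<in> ?S" and eq: "?p k = ?p l"
    then have kl: "nat \<bar>k\<bar> \<in> {1..n}" "nat \<bar>l\<bar> \<in> {1..n}" unfolding S by blast+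
    have "\<sigma> (nat \<bar>k\<bar>) = \<sigma> (nat \<bar>l\<bar>)"
      using signed_permutation_apply(1)[OF \<sigma>] kl eq by metis
    then have abs: "nat \<bar>k\<bar> = nat \<bar>l\<bar>" using \<sigma> by (metis permutes_inverses(2))
    moreover have "sgn k = sgn l"
      using signed_permutation_apply(2)[OF \<sigma> kl(1), of v] signed_permutation_apply(2)[OF \<sigma> kl(2), of v]
        eq abs by (simp split: if_splits)
    ultimately show "k = l" by (rule sgn_nat_abs_eqI[rotated])
  qed
  then have "bij_betw ?p ?S ?S"
    using image by (intro bij_betw_imageI endo_inj_surj) auto
  moreover have "?p k = k" if "k \<notin> ?S" for k
    using that unfolding S signed_permutation_def by (simp only: if_False)
  ultimately have "?p permutes ?S" by (rule bij_imp_permutes)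
  moreover have "?p (- k) = - ?p k" for k
    by (simp add: signed_permutation_def sgn_minus)
  ultimately show ?thesis by (simp add: W_B_def)
qed

lemma signed_permutation_inj:
  assumes \<sigma>: "\<sigma> permutes {1..n}" and \<tau>: "\<tau> permutes {1..n}"
    and v: "v \<in> carrier (C2_power n)" and w: "w \<in> carrier (C2_power n)"
    and eq: "signed_permutation n v \<sigma> = signed_permutation n w \<tau>"
  shows "v = w" "\<sigma> = \<tau>"
proof -
  have \<sigma>\<tau>: "\<sigma> i = \<tau> i" for i
  proof (cases "i \<in> {1..n}")
    case True
    then have "nat \<bar>int i\<bar> \<in> {1..n}" by simp
    then show ?thesis
      using signed_permutation_apply(1)[OF \<sigma>, of "int i" v]
        signed_permutation_apply(1)[OF \<tau>, of "int i" w] eq by simp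
  next
    case False
    then show ?thesis using \<sigma> \<tau> by (simp add: permutes_not_in)
  qed
  then show "\<sigma> = \<tau>" ..
  show "v = w"
  proof (rule C2_power_eqI[OF v w])
    fix i assume i: "i \<in> {1..n}"
    \<comment> \<open>The positive number sent to absolute value \<open>i\<close> exposes the sign
      stored in \<open>v i\<close>.\<close>
    let ?j = "inv' \<sigma> i"
    have "?j \<in> {1..n}" using \<sigma> i by (rule permutes_inv_in)
    then have "sgn (int ?j) = 1" and *: "nat \<bar>int ?j\<bar> \<in> {1..n}" by (simp_all add: sgn_if)
    moreover have "\<sigma> ?j = i" using \<sigma> by (rule permutes_inverses)
    ultimately show "v i = 1 \<longleftrightarrow> w i = 1"
      using signed_permutation_apply(2)[OF \<sigma> *, of v] signed_permutation_apply(2)[OF \<tau> *, of w] eq \<sigma>\<tau>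
      by (simp split: if_splits)
  qed
qed

text \<open>On positive numbers, \<open>\<sigma>\<close> keeps the absolute values of
  \<open>p\<close> and \<open>v\<close> marks the targets reached with a minus sign;
  \<open>p (- k) = - p k\<close> settles the negative numbers.\<close>

lemma signed_permutation_surj:
  assumes "p \<in> carrier (W_B n)"
  obtains v \<sigma> where "v \<in> carrier (C2_power n)" "\<sigma> permutes {1..n}" "p = signed_permutation n v \<sigma>"
proof -
  have p: "p permutes ({- int n..int n} - {0})" and odd: "p (- k) = - p k" for k
    using assms by (auto simp: W_B_def)
  have p_eq: "p k = p l \<longleftrightarrow> k = l" for k l using permutes_inj[OF p] by (auto dest: injD)
  have range: "nat \<bar>p k\<bar> \<in> {1..n} \<longleftrightarrow> nat \<bar>k\<bar> \<in> {1..n}" for k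
    using permutes_in_image[OF p, of k] by (simp only: signed_range_iff)
  define \<sigma> where "\<sigma> i = (if i \<in> {1..n} then nat \<bar>p (int i)\<bar> else i)" for i
  have "inj_on \<sigma> {1..n}"
  proof (rule inj_onI)
    fix i j assume ij: "i \<in> {1..n}" "j \<in> {1..n}" "\<sigma> i = \<sigma> j"
    \<comment> \<open>Equal absolute values give \<open>i = j\<close> or \<open>i = - j\<close>, and
      the latter is impossible for positive indices.\<close>
    then have "p (int i) = p (int j) \<or> p (int i) = p (- int j)"
      unfolding odd by (auto simp: \<sigma>_def)
    then show "i = j" using ij(1) unfolding p_eq by auto
  qed
  moreover have "\<sigma> i \<in> {1..n}" if "i \<in> {1..n}" for i
    using that range[of "int i"] by (simp add: \<sigma>_def)
  ultimately have "bij_betw \<sigma> {1..n} {1..n}"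
    by (intro bij_betw_imageI endo_inj_surj) auto
  then have \<sigma>: "\<sigma> permutes {1..n}" by (rule bij_imp_permutes) (auto simp: \<sigma>_def)
  define v where "v = (\<lambda>i\<in>{1..n}. if p (int (inv' \<sigma> i)) < 0 then 1 else 0 :: int)"
  have v: "v \<in> carrier (C2_power n)" by (simp add: v_def carrier_C2_power)
  have v_\<sigma>: "v (\<sigma> i) = 1 \<longleftrightarrow> p (int i) < 0" if "i \<in> {1..n}" for i
    using \<sigma> that permutes_in_image[OF \<sigma>, of i] by (simp add: v_def permutes_inverses)
  have pos: "p (int i) = signed_permutation n v \<sigma> (int i)" if i: "i \<in> {1..n}" for i
    using i v_\<sigma>[OF i] by (simp add: signed_permutation_def sgn_if) (simp add: \<sigma>_def)
  have odd': "signed_permutation n v \<sigma> (- k) = - signed_permutation n v \<sigma> k" for k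
    by (simp add: signed_permutation_def sgn_minus)
  have "p k = signed_permutation n v \<sigma> k" for k
  proof (cases "nat \<bar>k\<bar> \<in> {1..n}")
    case True
    then have "k = int (nat \<bar>k\<bar>) \<or> k = - int (nat \<bar>k\<bar>)" by auto
    then show ?thesis using pos[OF True] odd odd' by metis
  next
    case False
    then have "p k = k" by (intro permutes_not_in[OF p]) (simp only: signed_range_iff not_False_eq_True)
    then show ?thesis using False by (simp only: signed_permutation_def if_False)
  qed
  then show ?thesis using that v \<sigma> by blast
qed

lemma semidirect_iso_W_B:
  "semidirect_product (C2_power n) (sym_group n) (permute_coords n) \<cong> W_B n"
proof (rule is_isoI)
  let ?G = "semidirect_product (C2_power n) (sym_group n) (permute_coords n)"
  have G: "x \<in> carrier ?G \<longleftrightarrow> fst x \<in> carrier (C2_power n) \<and> snd x permutes {1..n}" for x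
    by (cases x) (simp add: semidirect_product_def sym_group_def)
  show "(\<lambda>(v, \<sigma>). signed_permutation n v \<sigma>) \<in> iso ?G (W_B n)"
    unfolding iso_def
  proof (intro CollectI conjI homI bij_betw_imageI inj_onI subset_antisym subsetI)
    fix x assume "x \<in> carrier ?G"
    then show "(case x of (v, \<sigma>) \<Rightarrow> signed_permutation n v \<sigma>) \<in> carrier (W_B n)"
      unfolding G by (simp add: case_prod_unfold signed_permutation_closed)
  next
    fix x y assume "x \<in> carrier ?G" "y \<in> carrier ?G"
    then show "(case x \<otimes>\<^bsub>?G\<^esub> y of (v, \<sigma>) \<Rightarrow> signed_permutation n v \<sigma>) =
        (case x of (v, \<sigma>) \<Rightarrow> signed_permutation n v \<sigma>) \<otimes>\<^bsub>W_B n\<^esub>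
        (case y of (v, \<sigma>) \<Rightarrow> signed_permutation n v \<sigma>)"
      unfolding G by (cases x; cases y)
        (simp add: semidirect_product_def sym_group_mult W_B_def signed_permutation_mult)
  next
    fix x y assume "x \<in> carrier ?G" "y \<in> carrier ?G"
      "(case x of (v, \<sigma>) \<Rightarrow> signed_permutation n v \<sigma>) = (case y of (v, \<sigma>) \<Rightarrow> signed_permutation n v \<sigma>)"
    then show "x = y"
      unfolding G case_prod_unfold by (intro prod_eqI) (blast dest: signed_permutation_inj)+
  next
    fix p assume "p \<in> (\<lambda>(v, \<sigma>). signed_permutation n v \<sigma>) ` carrier ?G"
    then show "p \<in> carrier (W_B n)"
      using G by (auto simp: signed_permutation_closed)
  next
    fix p assume "p \<in> carrier (W_B n)"
    then obtain v \<sigma> where "v \<in> carrier (C2_power n)" "\<sigma> permutes {1..n}" "p = signed_permutation n v \<sigma>"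
      by (rule signed_permutation_surj) (rule that)
    then show "p \<in> (\<lambda>(v, \<sigma>). signed_permutation n v \<sigma>) ` carrier ?G"
      using G by (intro image_eqI[of _ _ "(v, \<sigma>)"]) simp_all
  qed
qed

lemma order_C2_power: "order (C2_power n) = 2 ^ n"
  by (simp add: order_def carrier_C2_power card_PiE numeral_2_eq_2)

lemma order_sym_group: "order (sym_group n) = fact n"
  by (simp add: order_def sym_group_card_carrier)

lemma order_semidirect_product: "order (semidirect_product N H \<theta>) = order N * order H"
  by (simp add: order_def semidirect_product_def card_cartesian_product)

section \<open>The group in dimension four as automorphisms of the cube\<close>

abbreviation hyperoctahedral :: "((nat \<Rightarrow> int) \<times> (nat \<Rightarrow> nat)) monoid"
  where "hyperoctahedral \<equiv> semidirect_product (C2_power 4) (sym_group 4) (permute_coords 4)"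

lemma carrier_hyperoctahedral:
  "x \<in> carrier hyperoctahedral \<longleftrightarrow> fst x \<in> carrier (C2_power 4) \<and> snd x permutes {1..4}"
  by (cases x) (simp add: semidirect_product_def sym_group_def)

text \<open>Coordinates of the cube are residues 0 to 3, whereas \<open>sym_group 4\<close> acts on
  \<open>{1..4}\<close>; the shift by one links them, with 4 corresponding to the residue 3.\<close>

definition coord :: "4 \<Rightarrow> nat"
  where "coord = quad 1 2 3 4"

definition coord_inv :: "nat \<Rightarrow> 4"
  where "coord_inv n = of_nat n - 1"

lemma coord_range: "coord i \<in> {1..4}"
  by (cases i rule: cases_4; simp add: coord_def)

lemma coord_inv_coord: "coord_inv (coord i) = i"
  by (cases i rule: cases_4; simp add: coord_def coord_inv_def)

lemma coord_coord_inv: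
  assumes "n \<in> {1..4}"
  shows "coord (coord_inv n) = n"
proof -
  have "n = 1 \<or> n = 2 \<or> n = 3 \<or> n = 4" using assms by auto
  then show ?thesis by (auto simp: coord_def coord_inv_def)
qed

text \<open>Because of the inverse, \<open>\<sigma>\<close> moves the content of coordinate
  \<open>i\<close> to coordinate \<open>\<sigma> i\<close> up to renaming; \<open>v\<close>
  translates afterwards.\<close>

definition hyperoctahedral_aut :: "(nat \<Rightarrow> int) \<times> (nat \<Rightarrow> nat) \<Rightarrow> (4 \<Rightarrow> bool) \<Rightarrow> 4 \<Rightarrow> bool"
  where "hyperoctahedral_aut = (\<lambda>(v, \<sigma>) x i. x (coord_inv (inv' \<sigma> (coord i))) \<noteq> (v (coord i) = 1))"

lemma hyperoctahedral_aut_apply: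
  assumes "\<sigma> permutes {1..4}"
  shows "hyperoctahedral_aut (v, \<sigma>) x (coord_inv (\<sigma> (coord i))) = (x i \<noteq> (v (\<sigma> (coord i)) = 1))"
proof -
  have "\<sigma> (coord i) \<in> {1..4}" using assms coord_range[of i] by (simp only: permutes_in_image)
  then show ?thesis
    using assms by (simp add: hyperoctahedral_aut_def coord_coord_inv coord_inv_coord permutes_inverses)
qed

lemma bij_coord_perm:
  assumes "\<sigma> permutes {1..4}"
  shows "bij (\<lambda>i. coord_inv (\<sigma> (coord i)))"
proof (rule bij_betw_byWitness[where f' = "\<lambda>i. coord_inv (inv' \<sigma> (coord i))"])
  have "\<sigma> (coord i) \<in> {1..4}" "inv' \<sigma> (coord i) \<in> {1..4}" for i
    using coord_range[of i] assms by (simp_all only: permutes_in_image permutes_inv_in)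
  then show "\<forall>i\<in>UNIV. coord_inv (inv' \<sigma> (coord (coord_inv (\<sigma> (coord i))))) = i"
    "\<forall>i\<in>UNIV. coord_inv (\<sigma> (coord (coord_inv (inv' \<sigma> (coord i))))) = i"
    using assms by (simp_all add: coord_coord_inv permutes_inverses coord_inv_coord)
qed simp_all

text \<open>Values at the origin recover \<open>v\<close> and values at unit vectors recover
  \<open>\<sigma>\<close>, which gives injectivity; surjectivity comes from
  \<open>aut_Q4_cases\<close>.\<close>

lemma hyperoctahedral_aut_iso: "hyperoctahedral_aut \<in> iso hyperoctahedral (graph_aut Q4)"
  unfolding iso_def
proof (intro CollectI conjI homI bij_betw_imageI inj_onI subset_antisym subsetI)
  have closed: "hyperoctahedral_aut x \<in> carrier (graph_aut Q4)" if "x \<in> carrier hyperoctahedral" for x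
  proof -
    obtain v \<sigma> where x: "x = (v, \<sigma>)" by (cases x)
    have \<sigma>: "\<sigma> permutes {1..4}" using that x by (simp add: carrier_hyperoctahedral)
    show ?thesis
      using aut_Q4I[OF bij_coord_perm[OF \<sigma>] hyperoctahedral_aut_apply[OF \<sigma>, of v]]
      by (simp add: x graph_aut_def)
  qed
  then show "hyperoctahedral_aut x \<in> carrier (graph_aut Q4)" if "x \<in> carrier hyperoctahedral" for x
    using that .
  show "g \<in> carrier (graph_aut Q4)" if "g \<in> hyperoctahedral_aut ` carrier hyperoctahedral" for g
    using that closed by blast
next
  fix x y assume xy: "x \<in> carrier hyperoctahedral" "y \<in> carrier hyperoctahedral"
  obtain v \<sigma> w \<tau> where eq: "x = (v, \<sigma>)" "y = (w, \<tau>)" by (cases x; cases y)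
  have v: "v \<in> carrier (C2_power 4)" and \<sigma>: "\<sigma> permutes {1..4}"
    and w: "w \<in> carrier (C2_power 4)" and \<tau>: "\<tau> permutes {1..4}"
    using xy by (simp_all add: eq carrier_hyperoctahedral)
  have "hyperoctahedral_aut (v \<otimes>\<^bsub>C2_power 4\<^esub> permute_coords 4 \<sigma> w, \<sigma> \<circ> \<tau>) x i
      = hyperoctahedral_aut (v, \<sigma>) (hyperoctahedral_aut (w, \<tau>) x) i" for x i
  proof -
    have "inv' \<sigma> (coord i) \<in> {1..4}" using \<sigma> coord_range by (rule permutes_inv_in)
    moreover have "inv' (\<sigma> \<circ> \<tau>) (coord i) = inv' \<tau> (inv' \<sigma> (coord i))"
      using \<sigma> \<tau> by (simp add: o_inv_distrib permutes_bij)
    moreover have "(v \<otimes>\<^bsub>C2_power 4\<^esub> permute_coords 4 \<sigma> w) (coord i) = 1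
        \<longleftrightarrow> (v (coord i) = 1) \<noteq> (w (inv' \<sigma> (coord i)) = 1)"
      unfolding mult_C2_power_apply[OF v permute_coords_closed[OF \<sigma> w] coord_range]
      using coord_range[of i] by (simp add: permute_coords_def)
    ultimately show ?thesis
      unfolding hyperoctahedral_aut_def by (simp add: coord_coord_inv) blast
  qed
  then show "hyperoctahedral_aut (x \<otimes>\<^bsub>hyperoctahedral\<^esub> y)
      = hyperoctahedral_aut x \<otimes>\<^bsub>graph_aut Q4\<^esub> hyperoctahedral_aut y"
    by (simp add: eq semidirect_product_def sym_group_mult graph_aut_def fun_eq_iff)
next
  fix x y assume xy: "x \<in> carrier hyperoctahedral" "y \<in> carrier hyperoctahedral"
    and aut_eq: "hyperoctahedral_aut x = hyperoctahedral_aut y"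
  obtain v \<sigma> w \<tau> where eq: "x = (v, \<sigma>)" "y = (w, \<tau>)" by (cases x; cases y)
  have v: "v \<in> carrier (C2_power 4)" and \<sigma>: "\<sigma> permutes {1..4}"
    and w: "w \<in> carrier (C2_power 4)" and \<tau>: "\<tau> permutes {1..4}"
    using xy by (simp_all add: eq carrier_hyperoctahedral)
  have *: "(x (coord_inv (inv' \<sigma> (coord i))) \<noteq> (v (coord i) = 1))
      = (x (coord_inv (inv' \<tau> (coord i))) \<noteq> (w (coord i) = 1))" for x i
    using fun_cong[OF fun_cong[OF aut_eq, of x], of i] unfolding eq hyperoctahedral_aut_def prod.case .
  have vw_coord: "v (coord i) = 1 \<longleftrightarrow> w (coord i) = 1" for i
    using *[of "\<lambda>_. False" i] by blast
  then have vw: "v = w"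
    by (intro C2_power_eqI[OF v w]) (metis coord_coord_inv)
  have "coord_inv (inv' \<tau> (coord i)) = coord_inv (inv' \<sigma> (coord i))" for i
    using *[of "\<lambda>k. k = coord_inv (inv' \<sigma> (coord i))" i] vw by blast
  then have "inv' \<tau> n = inv' \<sigma> n" if "n \<in> {1..4}" for n
    using that \<sigma> \<tau> by (metis coord_coord_inv permutes_inv_in)
  then have "inv' \<tau> n = inv' \<sigma> n" for n
    using \<sigma> \<tau> by (cases "n \<in> {1..4}") (simp, metis permutes_not_in permutes_inv)
  then have "inv' \<tau> = inv' \<sigma>" ..
  then have "\<tau> = \<sigma>" using \<sigma> \<tau> by (metis permutes_inv_inv)
  then show "x = y" by (simp add: eq vw)
next
  fix g assume "g \<in> carrier (graph_aut Q4)"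
  then have "g \<in> graph_isos Q4 Q4" by (simp add: graph_aut_def)
  then obtain \<pi> a where \<pi>: "bij \<pi>" and g: "\<And>x i. g x (\<pi> i) = (x i \<noteq> a i)"
    by (rule aut_Q4_cases) (rule that)
  \<comment> \<open>Both parts are renumbered to \<open>{1..4}\<close>. The translation
    \<open>a\<close> is indexed by source coordinates and \<open>v\<close> by targets, hence the
    inverse of \<open>\<pi>\<close> in \<open>v\<close>.\<close>
  define \<sigma> where "\<sigma> n = (if n \<in> {1..4} then coord (\<pi> (coord_inv n)) else n)" for n
  define v where "v = (\<lambda>n\<in>{1..4}. if a (inv' \<pi> (coord_inv n)) then 1 else 0 :: int)"
  have "bij_betw \<sigma> {1..4} {1..4}"
  proof (rule bij_betw_byWitness[where f' = "\<lambda>n. coord (inv' \<pi> (coord_inv n))"])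
    show "\<forall>n\<in>{1..4}. coord (inv' \<pi> (coord_inv (\<sigma> n))) = n"
    proof
      fix n :: nat assume n: "n \<in> {1..4}"
      have "coord (inv' \<pi> (coord_inv (\<sigma> n))) = coord (inv' \<pi> (\<pi> (coord_inv n)))"
        using n by (simp only: \<sigma>_def if_True coord_inv_coord)
      then show "coord (inv' \<pi> (coord_inv (\<sigma> n))) = n"
        using \<pi> n by (simp only: inv_f_f bij_is_inj coord_coord_inv)
    qed
    show "\<forall>n\<in>{1..4}. \<sigma> (coord (inv' \<pi> (coord_inv n))) = n"
    proof
      fix n :: nat assume n: "n \<in> {1..4}"
      have "\<sigma> (coord (inv' \<pi> (coord_inv n))) = coord (\<pi> (inv' \<pi> (coord_inv n)))"
        by (simp only: \<sigma>_def coord_range if_True coord_inv_coord)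
      then show "\<sigma> (coord (inv' \<pi> (coord_inv n))) = n"
        using \<pi> n by (simp only: surj_f_inv_f bij_is_surj coord_coord_inv)
    qed
  qed (use coord_range in \<open>auto simp only: \<sigma>_def if_True\<close>)
  then have \<sigma>: "\<sigma> permutes {1..4}" by (rule bij_imp_permutes) (simp only: \<sigma>_def if_False)
  have "v \<in> carrier (C2_power 4)" by (simp add: v_def carrier_C2_power)
  then have "(v, \<sigma>) \<in> carrier hyperoctahedral" using \<sigma> by (simp add: carrier_hyperoctahedral)
  moreover have "g = hyperoctahedral_aut (v, \<sigma>)"
  proof (intro ext)
    fix x i
    have \<sigma>_coord: "\<sigma> (coord i) = coord (\<pi> i)" for i
      using coord_range[of i] by (simp only: \<sigma>_def if_True coord_inv_coord)
    have "v (coord (\<pi> i)) = 1 \<longleftrightarrow> a i" for i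
      using coord_range[of "\<pi> i"] \<pi> by (simp add: v_def coord_inv_coord bij_is_inj)
    then have "hyperoctahedral_aut (v, \<sigma>) x (\<pi> i) = (x i \<noteq> a i)" for i
      using hyperoctahedral_aut_apply[OF \<sigma>, of v x i] by (simp only: \<sigma>_coord coord_inv_coord)
    then have "g x = hyperoctahedral_aut (v, \<sigma>) x"
      by (intro surj_eqI[OF bij_is_surj[OF \<pi>]]) (simp only: g)
    then show "g x i = hyperoctahedral_aut (v, \<sigma>) x i" by (rule fun_cong)
  qed
  ultimately show "g \<in> hyperoctahedral_aut ` carrier hyperoctahedral" by (intro image_eqI)
qed

section \<open>The orbit of the Khajuraho square\<close>

lemma khajuraho_most_perfect: "khajuraho \<in> most_perfect_squares"
proof -
  have range: "range khajuraho = {1..16}"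
  proof -
    have "range khajuraho = (\<Union>i. \<Union>j. {khajuraho (i, j)})" by auto
    also have "\<dots> = {1..16}"
      by (simp add: UNIV_4 khajuraho_def) (auto, presburger)
    finally show ?thesis .
  qed
  \<comment> \<open>Sixteen positions mapped onto sixteen values leave no repetition.\<close>
  have "card (UNIV :: (4 \<times> 4) set) = card (range khajuraho)"
    unfolding range by simp
  then have "inj khajuraho" by (simp add: eq_card_imp_inj_on)
  then have "khajuraho \<in> arrangements" using range by (simp add: arrangements_def bij_betw_def)
  then show ?thesis
    unfolding most_perfect_squares_def all_4 sum_4 by (simp add: khajuraho_def)
qed

section \<open>Transport of invariance and transitivity to squares\<close>

lemma arrangements_comp: "M \<in> arrangements \<Longrightarrow> bij g \<Longrightarrow> M \<circ> g \<in> arrangements"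
  unfolding arrangements_def by (auto intro: bij_betw_trans)

lemma gray_conj_aut:
  assumes "g \<in> graph_isos C4xC4 C4xC4"
  shows "gray \<circ> g \<circ> gray_inv \<in> graph_isos Q4 Q4"
proof -
  have "inv' gray = gray_inv" by (rule inv_equality) simp_all
  then show ?thesis
    using graph_isos_comp[OF graph_isos_inv[OF gray_graph_iso] graph_isos_comp[OF assms gray_graph_iso]]
    by (simp add: comp_assoc)
qed

text \<open>Conjugation by the Gray code turns an automorphism of the torus into one of the cube,
  where \<open>balanced_aut\<close> applies.\<close>

lemma most_perfect_comp:
  assumes "M \<in> most_perfect_squares" "g \<in> graph_isos C4xC4 C4xC4"
  shows "M \<circ> g \<in> most_perfect_squares"
proof -
  have "M \<circ> g \<circ> gray_inv = (M \<circ> gray_inv) \<circ> (gray \<circ> g \<circ> gray_inv)"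
    by (simp add: fun_eq_iff)
  then show ?thesis
    using assms balanced_aut[OF _ gray_conj_aut[OF assms(2)]] arrangements_comp graph_isosD(1)
    unfolding most_perfect_iff by metis
qed

lemma most_perfect_transitive:
  assumes "M \<in> most_perfect_squares" "N \<in> most_perfect_squares"
  obtains g where "g \<in> graph_isos C4xC4 C4xC4" "M = N \<circ> g"
proof -
  have "bij gray_inv" by (rule bij_betw_byWitness[where f' = gray]) simp_all
  then have bal: "balanced (L \<circ> gray_inv)" "bij_betw (L \<circ> gray_inv) UNIV {1..16}"
    if "L \<in> most_perfect_squares" for L
    using that unfolding most_perfect_iff arrangements_def by (auto intro: bij_betw_trans)
  obtain h where h: "h \<in> graph_isos Q4 Q4" "M \<circ> gray_inv = N \<circ> gray_inv \<circ> h"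
    by (rule balanced_transitive[OF bal[OF assms(1)] bal[OF assms(2)]]) (rule that)
  have inv: "inv' gray = gray_inv" by (rule inv_equality) simp_all
  have "gray_inv \<circ> (h \<circ> gray) \<in> graph_isos C4xC4 C4xC4"
    using graph_isos_comp[OF graph_isos_comp[OF gray_graph_iso h(1)] graph_isos_inv[OF gray_graph_iso]]
    by (simp add: inv)
  moreover have "M x = (N \<circ> (gray_inv \<circ> (h \<circ> gray))) x" for x
    using fun_cong[OF h(2), of "gray x"] by simp
  then have "M = N \<circ> (gray_inv \<circ> (h \<circ> gray))" ..
  ultimately show ?thesis by (rule that)
qed

lemma khajuraho_orbit:
  "{khajuraho \<circ> g | g. g \<in> graph_isos C4xC4 C4xC4} = most_perfect_squares"
proof (intro subset_antisym subsetI)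
  fix M assume "M \<in> most_perfect_squares"
  then obtain g where "g \<in> graph_isos C4xC4 C4xC4" "M = khajuraho \<circ> g"
    by (rule most_perfect_transitive[OF _ khajuraho_most_perfect]) (rule that)
  then show "M \<in> {khajuraho \<circ> g | g. g \<in> graph_isos C4xC4 C4xC4}" by blast
qed (use most_perfect_comp[OF khajuraho_most_perfect] in blast)

theorem theorem8:
  shows "graph_isos C4xC4 Q4 \<noteq> {}
    \<and> (\<forall>\<phi> \<in> graph_isos C4xC4 Q4.
         (\<lambda>g. \<phi> \<circ> g \<circ> inv_into UNIV \<phi>) \<in> iso (graph_aut C4xC4) (graph_aut Q4)
       \<and> faithful_action (graph_aut Q4) most_perfect_squares
           (\<lambda>h. position_action most_perfect_squares (inv_into UNIV \<phi> \<circ> h \<circ> \<phi>))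
       \<and> orbit (graph_aut Q4)
           (\<lambda>h. position_action arrangements (inv_into UNIV \<phi> \<circ> h \<circ> \<phi>)) khajuraho
         = most_perfect_squares)
    \<and> card most_perfect_squares = 384
    \<and> faithful_action (graph_aut C4xC4) arrangements (position_action arrangements)
    \<and> faithful_action (graph_aut C4xC4) most_perfect_squares (position_action most_perfect_squares)
    \<and> orbit (graph_aut C4xC4) (position_action arrangements) khajuraho = most_perfect_squares
    \<and> graph_aut Q4 \<cong> W_B 4
    \<and> W_B 4 \<cong> semidirect_product (C2_power 4) (sym_group 4) (permute_coords 4)
    \<and> order (C2_power 4) = 16
    \<and> order (sym_group 4) = 24
    \<and> order (graph_aut C4xC4) = 384"
proof (intro conjI ballI)
  have khajuraho: "khajuraho \<in> arrangements" "inj khajuraho"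
    using khajuraho_most_perfect
    by (auto simp: most_perfect_squares_def arrangements_def bij_betw_def)
  interpret hyperoctahedral: group hyperoctahedral by (rule group_hyperoctahedral)
  have hyperoctahedral: "hyperoctahedral \<cong> graph_aut Q4"
    using hyperoctahedral_aut_iso by (rule is_isoI)
  show "graph_isos C4xC4 Q4 \<noteq> {}" using gray_graph_iso by blast
  show "order (C2_power 4) = 16" "order (sym_group 4) = 24"
    by (simp_all add: order_C2_power order_sym_group fact_numeral)
  then have "order (graph_aut Q4) = 384"
    using iso_same_card[OF hyperoctahedral] order_semidirect_product[of "C2_power 4" "sym_group 4"]
    by (simp add: order_def)
  moreover have "graph_aut C4xC4 \<cong> graph_aut Q4"
    using graph_iso_conj[OF gray_graph_iso] by (rule is_isoI)
  ultimately show order: "order (graph_aut C4xC4) = 384"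
    by (simp add: order_def iso_same_card)
  show "W_B 4 \<cong> hyperoctahedral"
    using semidirect_iso_W_B by (rule hyperoctahedral.iso_sym)
  show "graph_aut Q4 \<cong> W_B 4"
    using hyperoctahedral.iso_sym[OF hyperoctahedral] semidirect_iso_W_B by (rule iso_trans)
  show "faithful_action (graph_aut C4xC4) arrangements (position_action arrangements)"
    using khajuraho by (intro faithful_position_action) (auto intro: arrangements_comp graph_isosD(1))
  show faithful: "faithful_action (graph_aut C4xC4) most_perfect_squares (position_action most_perfect_squares)"
    by (rule faithful_position_action[OF most_perfect_comp khajuraho_most_perfect khajuraho(2)])
  show orbit: "orbit (graph_aut C4xC4) (position_action arrangements) khajuraho = most_perfect_squares"
    using orbit_position_action[OF khajuraho(1)] khajuraho_orbit by simp
  \<comment> \<open>Distinct entries make different automorphisms give different squares, so the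
    orbit is as large as the group.\<close>
  have "inj_on (\<lambda>g. khajuraho \<circ> g) (graph_isos C4xC4 C4xC4)"
    using khajuraho(2) by (intro inj_onI) (metis fun.inj_map injD)
  then have "card ((\<lambda>g. khajuraho \<circ> g) ` graph_isos C4xC4 C4xC4) = 384"
    using order by (simp add: card_image order_def graph_aut_def)
  moreover have "(\<lambda>g. khajuraho \<circ> g) ` graph_isos C4xC4 C4xC4 = most_perfect_squares"
    using khajuraho_orbit by (simp add: image_def Bex_def conj_commute)
  ultimately show "card most_perfect_squares = 384" by simp
  fix \<phi> assume \<phi>: "\<phi> \<in> graph_isos C4xC4 Q4"
  show "(\<lambda>g. \<phi> \<circ> g \<circ> inv_into UNIV \<phi>) \<in> iso (graph_aut C4xC4) (graph_aut Q4)"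
    using \<phi> by (rule graph_iso_conj)
  have "inv' (inv' \<phi>) = \<phi>" using graph_isosD(1)[OF \<phi>] by (rule inv_inv_eq)
  then have iso: "(\<lambda>h. inv' \<phi> \<circ> h \<circ> \<phi>) \<in> iso (graph_aut Q4) (graph_aut C4xC4)"
    using graph_iso_conj[OF graph_isos_inv[OF \<phi>]] by simp
  show "faithful_action (graph_aut Q4) most_perfect_squares
      (\<lambda>h. position_action most_perfect_squares (inv_into UNIV \<phi> \<circ> h \<circ> \<phi>))"
    using faithful group_graph_aut iso by (rule faithful_action_iso)
  \<comment> \<open>Conjugation runs through all automorphisms of the torus, so both groups have the
    same orbit, whichever \<open>\<phi>\<close> is chosen.\<close>
  have "(\<lambda>h. inv' \<phi> \<circ> h \<circ> \<phi>) ` carrier (graph_aut Q4) = carrier (graph_aut C4xC4)"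
    using iso by (simp add: iso_def bij_betw_def)
  note image = this[symmetric]
  have "orbit (graph_aut Q4) (\<lambda>h. position_action arrangements (inv' \<phi> \<circ> h \<circ> \<phi>)) khajuraho
      = orbit (graph_aut C4xC4) (position_action arrangements) khajuraho"
    by (simp only: orbit_eq_image image image_image)
  then show "orbit (graph_aut Q4)
      (\<lambda>h. position_action arrangements (inv_into UNIV \<phi> \<circ> h \<circ> \<phi>)) khajuraho = most_perfect_squares"
    using orbit by simp
qed

end
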